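(* Let $q\ge 1$ be an integer, $n>0$ real, $S$ a symmetric real $q\times q$ matrix and $F$ a real $q\times q$ matrix. The first-order inverse Wishart autoregressive process $\{\Sigma_t\}_{t\ge 0}$ with parameters $(n,F,S)$ is strictly stationary whenever the parametrization of its defining $2q\times 2q$ inverse Wishart distribution yields a valid distribution, that is, whenever $S$ and $S-FSF'$ are both positive definite.
   Context: A prime denotes transpose. For an integer $m\ge1$, a real $d>0$ and a symmetric positive definite $m\times m$ matrix $D$, $\mathrm{IW}_m(d,D)$ denotes the distribution on symmetric positive definite $m\times m$ matrices $X$ with density proportional to $|X|^{-(d+2m)/2}\exp\{-\tfrac12\mathrm{tr}(X^{-1}D)\}$; for $d>2$ its mean is $D/(d-2)$. Definition of the process. Let $p(\Sigma_{t-1},\Sigma_t)$ be the joint density of the two diagonal $q\times q$ blocks of a random $2q\times 2q$ matrix $$\begin{pmatrix}\Sigma_{t-1}&\phi_t'\\ \phi_t&\Sigma_t\end{pmatrix}\sim \mathrm{IW}_{2q}\left(n+2,\;n\begin{pmatrix}S & SF' \\ F S & S\end{pmatrix}\right).$$ The inverse Wishart distribution is valid when the scale matrix is positive definite. Both diagonal blocks then have the same marginal density $p(\Sigma)$, namely that of $\mathrm{IW}_q(n+2,nS)$. The first-order inverse Wishart autoregressive process with parameters $(n,F,S)$ is the first-order Markov process $\{\Sigma_t\}_{t\ge0}$ whose joint density for every $T\ge 1$ is $$p(\Sigma_{0},\dots,\Sigma_T)=\frac{\prod_{t=1}^T p(\Sigma_{t-1},\Sigma_t)}{\prod_{t=2}^T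 p(\Sigma_{t-1})},$$ i.e. $\Sigma_0\sim \mathrm{IW}_q(n+2,nS)$ and the transition from $\Sigma_{t-1}$ to $\Sigma_t$ is the conditional density $p(\Sigma_t\mid\Sigma_{t-1})=p(\Sigma_{t-1},\Sigma_t)/p(\Sigma_{t-1})$, where $p(\Sigma_{t-1},\Sigma_t)$ is the joint density of the two diagonal $q\times q$ blocks of the $\mathrm{IW}_{2q}$ random matrix and $p(\Sigma_{t-1})$ is the $\mathrm{IW}_q(n+2,nS)$ density. Strictly stationary means that for all $k\ge0$ the joint law of $(\Sigma_s,\dots,\Sigma_{s+k})$ does not depend on $s\ge 0$. *)

theory Defs
  imports "HOL-Probability.Probability"
begin

definition posdef :: "real^'m^'m \<Rightarrow> bool" where
  "posdef A \<longleftrightarrow> transpose A = A \<and> (\<forall>x. x \<noteq> 0 \<longrightarrow> x \<bullet> (A *v x) > 0)"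

text \<open>
  Lebesgue measure on the space of symmetric matrices, i.e. \<open>\<Prod>\<^bsub>i\<le>j\<^esub> dx\<^bsub>ij\<^esub>\<close>, the reference
  measure of all matrix densities below.  A symmetric matrix is given by one real coordinate for
  each unordered pair \<open>{i, j}\<close> of indices (with \<open>i = j\<close> allowed), so no order on the index
  type is needed.  The measure lives on the Borel sets of all matrices and is concentrated on the
  symmetric ones.
\<close>

definition sym_lborel :: "(real^'m^'m) measure" where
  "sym_lborel = distr (Pi\<^sub>M {{i, j} |i j :: 'm. True} (\<lambda>_. lborel)) borel (\<lambda>x. \<chi> i j. x {i, j})"

definition iw_kernel :: "real \<Rightarrow> real^'m^'m \<Rightarrow> real^'m^'m \<Rightarrow> real" where
  "iw_kernel d D X =
     (if posdef X
      then det X powr (- (d + 2 * real CARD('m)) / 2) * exp (- (1/2) * trace (matrix_inv X ** D))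
      else 0)"

definition iw_density :: "real \<Rightarrow> real^'m^'m \<Rightarrow> real^'m^'m \<Rightarrow> ennreal" where
  "iw_density d D X = ennreal (iw_kernel d D X) / (\<integral>\<^sup>+ Y. ennreal (iw_kernel d D Y) \<partial>sym_lborel)"

definition inverse_wishart :: "real \<Rightarrow> real^'m^'m \<Rightarrow> (real^'m^'m) measure" where
  "inverse_wishart d D = density sym_lborel (iw_density d D)"

definition iw_valid :: "real \<Rightarrow> real^'m^'m \<Rightarrow> bool" where
  "iw_valid d D \<longleftrightarrow> d > 0 \<and> posdef D"

text \<open>
  Matrices of size \<open>2q\<close> are indexed by the sum type \<open>'q + 'q\<close>; \<open>Inl\<close> is the first block of
  indices and \<open>Inr\<close> the second.
\<close>

definition block_matrix ::
  "real^'q^'q \<Rightarrow> real^'q^'q \<Rightarrow> real^'q^'q \<Rightarrow> real^'q^'q \<Rightarrow> real^('q + 'q)^('q + 'q)" where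
  "block_matrix A B C D =
     (\<chi> a b. case a of
        Inl i \<Rightarrow> (case b of Inl j \<Rightarrow> A $ i $ j | Inr j \<Rightarrow> B $ i $ j)
      | Inr i \<Rightarrow> (case b of Inl j \<Rightarrow> C $ i $ j | Inr j \<Rightarrow> D $ i $ j))"

definition upper_block :: "real^('q + 'q)^('q + 'q) \<Rightarrow> real^'q^'q" where
  "upper_block X = (\<chi> i j. X $ Inl i $ Inl j)"

definition lower_block :: "real^('q + 'q)^('q + 'q) \<Rightarrow> real^'q^'q" where
  "lower_block X = (\<chi> i j. X $ Inr i $ Inr j)"

definition iwar_scale :: "real \<Rightarrow> real^'q^'q \<Rightarrow> real^'q^'q \<Rightarrow> real^('q + 'q)^('q + 'q)" where
  "iwar_scale n F S = n *\<^sub>R block_matrix S (S ** transpose F) (F ** S) S"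

text \<open>
  \<open>p\<close> is a joint density of the two diagonal blocks of the \<open>2q \<times> 2q\<close> inverse Wishart matrix.
  It is determined up to null sets, which does not affect the joint densities of the process.
\<close>

definition iwar_pair_density ::
  "real \<Rightarrow> real^'q^'q \<Rightarrow> real^'q^'q \<Rightarrow> ((real^'q^'q) \<times> (real^'q^'q) \<Rightarrow> ennreal) \<Rightarrow> bool" where
  "iwar_pair_density n F S p \<longleftrightarrow>
     distributed (inverse_wishart (n + 2) (iwar_scale n F S)) (sym_lborel \<Otimes>\<^sub>M sym_lborel)
       (\<lambda>X. (upper_block X, lower_block X)) p"

text \<open>
  The joint densities for all \<open>T \<ge> 1\<close> determine all finite-dimensional laws, and their product
  form is the first-order Markov property with initial density \<open>p(\<Sigma>\<^sub>0)\<close> and transition density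
  \<open>p(\<Sigma>\<^bsub>t-1\<^esub>, \<Sigma>\<^sub>t) / p(\<Sigma>\<^bsub>t-1\<^esub>)\<close>.
\<close>

definition iwar_process ::
  "real \<Rightarrow> real^'q^'q \<Rightarrow> real^'q^'q \<Rightarrow> 'w measure \<Rightarrow> (nat \<Rightarrow> 'w \<Rightarrow> real^'q^'q) \<Rightarrow> bool" where
  "iwar_process n F S M \<Sigma> \<longleftrightarrow>
     prob_space M \<and>
     (\<forall>t. \<Sigma> t \<in> borel_measurable M) \<and>
     (\<exists>p. iwar_pair_density n F S p \<and>
       (\<forall>T\<ge>1. distributed M (Pi\<^sub>M {0..T} (\<lambda>_. sym_lborel)) (\<lambda>\<omega>. \<lambda>t\<in>{0..T}. \<Sigma> t \<omega>)
          (\<lambda>x. (\<Prod>t=1..T. p (x (t - 1), x t)) /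
               (\<Prod>t=2..T. iw_density (n + 2) (n *\<^sub>R S) (x (t - 1))))))"

definition strictly_stationary ::
  "'w measure \<Rightarrow> (nat \<Rightarrow> 'w \<Rightarrow> 'b::topological_space) \<Rightarrow> bool" where
  "strictly_stationary M X \<longleftrightarrow>
     (\<forall>k s s'. distr M (Pi\<^sub>M {0..k} (\<lambda>_. borel)) (\<lambda>\<omega>. \<lambda>i\<in>{0..k}. X (s + i) \<omega>) =
               distr M (Pi\<^sub>M {0..k} (\<lambda>_. borel)) (\<lambda>\<omega>. \<lambda>i\<in>{0..k}. X (s' + i) \<omega>))"

end

theory Submission
  imports Defs
begin

text \<open>
  For invertible \<open>A\<close> the map \<open>X \<mapsto> A X A'\<close> sends \<open>IW(d, D)\<close> to \<open>IW(d, A D A')\<close>: it scales Lebesgue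
  measure on symmetric matrices by a constant (uniqueness of translation-invariant measures) and
  the kernel by another constant.  Block elimination leaves the upper block of \<open>X\<close> unchanged and
  turns the scale matrix into \<open>n diag(S, 1)\<close>, and exchanging the two blocks reduces the lower block
  to the upper one.  Hence both diagonal blocks have the same law, with density \<open>h\<close> say.

  It is not necessary to compute that \<open>h\<close> is the \<open>IW(n + 2, n S)\<close> density \<open>g\<close>: the joint densities for
  \<open>T = 1\<close> and \<open>T = 2\<close> give the same law of \<open>\<Sigma>\<^sub>1\<close> only if \<open>h = h h / g\<close>, so \<open>h = g\<close> wherever \<open>h > 0\<close>.
  Integrating \<open>\<Sigma>\<^sub>0\<close> out of the density of \<open>(\<Sigma>\<^sub>0, \<dots>, \<Sigma>\<^bsub>T+1\<^esub>)\<close> therefore returns the density of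
  \<open>(\<Sigma>\<^sub>0, \<dots>, \<Sigma>\<^sub>T)\<close>.
\<close>

subsection \<open>Positive definite and block matrices\<close>

lemma posdefD_sym: "posdef A \<Longrightarrow> transpose A = A"
  and posdefD_pos: "posdef A \<Longrightarrow> x \<noteq> 0 \<Longrightarrow> x \<bullet> (A *v x) > 0"
  by (auto simp: posdef_def)

lemma inner_matrix_vector_transpose:
  fixes A :: "real^'n^'m"
  shows "x \<bullet> (A *v y) = (transpose A *v x) \<bullet> y"
  by (simp add: dot_lmul_matrix)

lemma inner_matrix_vector_sym:
  fixes A :: "real^'m^'m"
  assumes "transpose A = A"
  shows "x \<bullet> (A *v y) = y \<bullet> (A *v x)"
  by (metis assms inner_matrix_vector_transpose inner_commute)

lemma posdef_congruence:
  fixes A D :: "real^'m^'m"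
  assumes "invertible A" "posdef D"
  shows "posdef (A ** D ** transpose A)"
  unfolding posdef_def
proof (intro conjI allI impI)
  show "transpose (A ** D ** transpose A) = A ** D ** transpose A"
    using posdefD_sym[OF assms(2)] by (simp add: matrix_transpose_mul matrix_mul_assoc)
  fix x :: "real^'m"
  assume "x \<noteq> 0"
  obtain B where B: "transpose B ** transpose A = mat 1"
    using assms(1) unfolding invertible_def
    by (metis matrix_transpose_mul transpose_mat)
  have "transpose A *v x \<noteq> 0"
  proof
    assume "transpose A *v x = 0"
    then have "(transpose B ** transpose A) *v x = 0"
      by (metis matrix_vector_mul_assoc matrix_vector_mult_0_right)
    with B \<open>x \<noteq> 0\<close> show False by simp
  qed
  from posdefD_pos[OF assms(2) this]
  show "0 < x \<bullet> ((A ** D ** transpose A) *v x)"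
    by (simp add: inner_matrix_vector_transpose[of x A] flip: matrix_vector_mul_assoc)
qed

text \<open>\<open>matrix_inv\<close> is a choice of two-sided inverse. A right inverse of a square
  matrix is two-sided and inverses are unique, so the choice is forced.\<close>

lemma matrix_inv_eqI:
  fixes A B :: "real^'m^'m"
  assumes "A ** B = mat 1"
  shows "matrix_inv A = B"
proof -
  have "A ** B = mat 1 \<and> B ** A = mat 1"
    using assms matrix_left_right_inverse by blast
  then have "A ** matrix_inv A = mat 1 \<and> matrix_inv A ** A = mat 1"
    unfolding matrix_inv_def by (rule someI)
  then show ?thesis
    by (metis assms matrix_mul_assoc matrix_mul_lid matrix_mul_rid)
qed

text \<open>Gram-Schmidt for the inner product \<open>x \<bullet> (B *v y)\<close>, by induction
  over the index set. With \<open>J = UNIV\<close> it supplies a full orthonormal basis.\<close>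

lemma posdef_orthonormal_family:
  fixes B :: "real^'m^'m" and J :: "'m set"
  assumes "posdef B" "finite J"
  shows "\<exists>v. \<forall>i\<in>J. \<forall>j\<in>J. v i \<bullet> (B *v v j) = (if i = j then 1 else 0)"
  using assms(2)
proof induction
  case (insert k J)
  then obtain v where v: "\<And>i j. i \<in> J \<Longrightarrow> j \<in> J \<Longrightarrow> v i \<bullet> (B *v v j) = (if i = j then 1 else 0)"
    by blast
  \<comment> \<open>As \<open>k\<close> lies outside \<open>J\<close>, there are fewer vectors so
    far than the dimension, so they cannot span and some \<open>u\<close> is left over.\<close>
  have "card J < CARD('m)"
    using insert.hyps by (metis UNIV_I finite psubset_card_mono psubsetI subset_UNIV)
  moreover have "dim (v ` J) \<le> card (v ` J)"
    using insert.hyps(1) by (intro dim_le_card span_superset) simp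
  ultimately have "dim (v ` J) < CARD('m)"
    using card_image_le[OF insert.hyps(1), of v] by linarith
  then have "span (v ` J) \<noteq> UNIV"
    using dim_eq_full[of "v ` J"] by auto
  then obtain u where u: "u \<notin> span (v ` J)" by blast
  \<comment> \<open>The part of \<open>u\<close> that is \<open>B\<close>-orthogonal to the earlier
    vectors; it is nonzero because \<open>u\<close> is outside their span.\<close>
  define w where "w = u - (\<Sum>j\<in>J. (v j \<bullet> (B *v u)) *\<^sub>R v j)"
  have "(\<Sum>j\<in>J. (v j \<bullet> (B *v u)) *\<^sub>R v j) \<in> span (v ` J)"
    by (intro span_sum span_scale span_base) simp
  then have "w \<noteq> 0" using u by (auto simp: w_def)
  have vw: "v i \<bullet> (B *v w) = 0" if "i \<in> J" for i
  proof -
    have "B *v w = B *v u - (\<Sum>j\<in>J. (v j \<bullet> (B *v u)) *\<^sub>R (B *v v j))"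
      unfolding w_def matrix_vector_mult_diff_distrib
      by (simp add: linear_sum[OF matrix_vector_mul_linear] matrix_vector_mult_scaleR)
    then have "v i \<bullet> (B *v w) = v i \<bullet> (B *v u) - (\<Sum>j\<in>J. (v j \<bullet> (B *v u)) * (v i \<bullet> (B *v v j)))"
      by (simp add: inner_diff_right inner_sum_right)
    also have "(\<Sum>j\<in>J. (v j \<bullet> (B *v u)) * (v i \<bullet> (B *v v j))) = (\<Sum>j\<in>J. if j = i then v j \<bullet> (B *v u) else 0)"
      by (rule sum.cong) (auto simp: v that)
    also have "\<dots> = v i \<bullet> (B *v u)"
      using insert.hyps(1) that by simp
    finally show ?thesis by simp
  qed
  have wv: "w \<bullet> (B *v v i) = 0" if "i \<in> J" for i
    using vw[OF that] inner_matrix_vector_sym[OF posdefD_sym[OF assms(1)]] by metis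
  define s where "s = w \<bullet> (B *v w)"
  have s: "s > 0"
    unfolding s_def using posdefD_pos[OF assms(1) \<open>w \<noteq> 0\<close>] .
  define v' where "v' = v(k := (1 / sqrt s) *\<^sub>R w)"
  have "v' i \<bullet> (B *v v' j) = (if i = j then 1 else 0)" if "i \<in> insert k J" "j \<in> insert k J" for i j
    using that insert.hyps(2) s v vw wv
    by (auto simp: v'_def matrix_vector_mult_scaleR s_def[symmetric])
  then show ?case by blast
qed simp

text \<open>The rows of \<open>E\<close> are a \<open>B\<close>-orthonormal basis, so that
  \<open>E ** B ** transpose E\<close> is its Gram matrix.\<close>

lemma posdef_congruent_mat_1:
  fixes B :: "real^'m^'m"
  assumes "posdef B"
  obtains E :: "real^'m^'m" where "invertible E" "E ** B ** transpose E = mat 1"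
proof -
  obtain v :: "'m \<Rightarrow> real^'m" where v: "\<And>i j. v i \<bullet> (B *v v j) = (if i = j then 1 else 0)"
    using posdef_orthonormal_family[OF assms finite_class.finite_UNIV] by auto
  define E :: "real^'m^'m" where "E = (\<chi> i. v i)"
  have *: "(E ** B ** transpose E) $ i $ j = v i \<bullet> (B *v v j)" for i j
    by (simp add: E_def matrix_matrix_mult_def matrix_vector_mult_def transpose_def inner_vec_def
        sum_distrib_left sum_distrib_right mult.assoc) (rule sum.swap)
  have 1: "E ** B ** transpose E = mat 1"
    by (simp add: vec_eq_iff * v mat_def)
  then have "invertible E"
    by (metis invertible_right_inverse matrix_mul_assoc)
  with 1 that show thesis by blast
qed

text \<open>Taking determinants in the congruence to \<open>mat 1\<close> gives
  \<open>(det E)\<^sup>2 * det B = 1\<close>.\<close>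

lemma posdef_det_pos:
  fixes B :: "real^'m^'m"
  assumes "posdef B"
  shows "det B > 0"
proof -
  obtain E :: "real^'m^'m" where "E ** B ** transpose E = mat 1"
    by (rule posdef_congruent_mat_1[OF assms])
  from arg_cong[OF this, of det] have "(det E)\<^sup>2 * det B = 1"
    by (simp add: det_mul power2_eq_square mult_ac)
  then show ?thesis
    by (metis mult_zero_right not_one_less_zero zero_less_mult_pos zero_less_one
        zero_le_power2 mult_nonneg_nonpos not_le order_less_le zero_less_power2)
qed

text \<open>The inverse of A X A' is B' Y B with B and Y the inverses of A and X; cyclicity of the
  trace then cancels A against B. This makes the exponent of the kernel invariant under
  congruence.\<close>

lemma trace_inv_congruence:
  fixes A X D :: "real^'m^'m"
  assumes "invertible A" "invertible X"
  shows "trace (matrix_inv (A ** X ** transpose A) ** (A ** D ** transpose A)) = trace (matrix_inv X ** D)"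
proof -
  obtain B where B: "A ** B = mat 1" "B ** A = mat 1"
    using assms(1) unfolding invertible_def by blast
  obtain Y where Y: "X ** Y = mat 1" "Y ** X = mat 1"
    using assms(2) unfolding invertible_def by blast
  have tB: "transpose A ** transpose B = mat 1"
    using B by (metis matrix_transpose_mul transpose_mat)
  have "(A ** X ** transpose A) ** (transpose B ** Y ** B) = A ** X ** (transpose A ** transpose B) ** Y ** B"
    by (simp add: matrix_mul_assoc)
  also have "\<dots> = A ** (X ** Y) ** B"
    by (simp add: tB matrix_mul_assoc)
  also have "\<dots> = mat 1" by (simp add: Y B)
  finally have "matrix_inv (A ** X ** transpose A) = transpose B ** Y ** B"
    by (rule matrix_inv_eqI)
  then have "trace (matrix_inv (A ** X ** transpose A) ** (A ** D ** transpose A))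
      = trace (transpose B ** Y ** (B ** A) ** D ** transpose A)"
    by (simp add: matrix_mul_assoc)
  also have "\<dots> = trace (transpose B ** (Y ** D ** transpose A))"
    by (simp add: B matrix_mul_assoc)
  also have "\<dots> = trace (Y ** D ** (transpose A ** transpose B))"
    by (subst trace_mul_sym) (simp add: matrix_mul_assoc)
  finally show ?thesis
    by (simp add: tB matrix_inv_eqI[OF Y(1)])
qed

section \<open>Block matrices, and block elimination for the scale matrix\<close>

lemma block_matrix_nth [simp]:
  "block_matrix A B C D $ Inl i $ Inl j = A $ i $ j"
  "block_matrix A B C D $ Inl i $ Inr j = B $ i $ j"
  "block_matrix A B C D $ Inr i $ Inl j = C $ i $ j"
  "block_matrix A B C D $ Inr i $ Inr j = D $ i $ j"
  by (simp_all add: block_matrix_def)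

lemma upper_block_nth [simp]: "upper_block X $ i $ j = X $ Inl i $ Inl j"
  and lower_block_nth [simp]: "lower_block X $ i $ j = X $ Inr i $ Inr j"
  by (simp_all add: upper_block_def lower_block_def)

lemma matrix_sum_type_eq_iff:
  fixes X Y :: "real^('q::finite + 'q)^('q + 'q)"
  shows "X = Y \<longleftrightarrow> (\<forall>i j. X $ Inl i $ Inl j = Y $ Inl i $ Inl j \<and> X $ Inl i $ Inr j = Y $ Inl i $ Inr j
    \<and> X $ Inr i $ Inl j = Y $ Inr i $ Inl j \<and> X $ Inr i $ Inr j = Y $ Inr i $ Inr j)"
  unfolding vec_eq_iff split_sum_all by blast

lemma sum_UNIV_sum_type:
  fixes f :: "'a::finite + 'b::finite \<Rightarrow> 'c::comm_monoid_add"
  shows "(\<Sum>x\<in>UNIV. f x) = (\<Sum>x\<in>UNIV. f (Inl x)) + (\<Sum>x\<in>UNIV. f (Inr x))"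
  by (simp add: sum.Plus flip: UNIV_Plus_UNIV)

lemma block_matrix_mult:
  "block_matrix A B C D ** block_matrix A' B' C' D' =
    block_matrix (A ** A' + B ** C') (A ** B' + B ** D') (C ** A' + D ** C') (C ** B' + D ** D')"
  by (simp add: matrix_sum_type_eq_iff matrix_matrix_mult_def sum_UNIV_sum_type)

lemma block_matrix_transpose:
  "transpose (block_matrix A B C D) = block_matrix (transpose A) (transpose C) (transpose B) (transpose D)"
  by (simp add: matrix_sum_type_eq_iff transpose_def)

lemma block_matrix_mat_1: "block_matrix (mat 1) 0 0 (mat 1) = mat 1"
  by (simp add: matrix_sum_type_eq_iff mat_def)

lemma block_matrix_collapse:
  "block_matrix (upper_block X) (\<chi> i j. X $ Inl i $ Inr j) (\<chi> i j. X $ Inr i $ Inl j) (lower_block X) = X"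
  by (simp add: matrix_sum_type_eq_iff)

lemma upper_block_matrix [simp]: "upper_block (block_matrix A B C D) = A"
  and lower_block_matrix [simp]: "lower_block (block_matrix A B C D) = D"
  by (simp_all add: vec_eq_iff)

lemma transpose_zero [simp]: "transpose (0::real^'n^'m) = 0"
  by (simp add: vec_eq_iff transpose_def)

abbreviation swap_matrix :: "real^('q::finite + 'q)^('q + 'q)" where
  "swap_matrix \<equiv> block_matrix 0 (mat 1) (mat 1) 0"

lemma swap_matrix_invertible: "invertible swap_matrix"
  unfolding invertible_left_inverse
  by (rule exI[of _ swap_matrix]) (simp add: block_matrix_mult block_matrix_mat_1)

lemma upper_block_swap:
  fixes X :: "real^('q::finite + 'q)^('q + 'q)"
  shows "upper_block (swap_matrix ** X ** transpose swap_matrix) = lower_block X"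
  by (subst block_matrix_collapse[of X, symmetric])
     (simp add: block_matrix_mult block_matrix_transpose)

text \<open>The first block row of the multiplier is that of the identity, so block elimination does
  not touch the upper block.\<close>

lemma upper_block_congruence:
  fixes X :: "real^('q::finite + 'q)^('q + 'q)"
  shows "upper_block (block_matrix (mat 1) 0 C E ** X ** transpose (block_matrix (mat 1) 0 C E)) = upper_block X"
  by (subst block_matrix_collapse[of X, symmetric])
     (simp add: block_matrix_mult block_matrix_transpose)

lemma block_triangular_invertible:
  fixes C E :: "real^'q^'q"
  assumes "invertible E"
  shows "invertible (block_matrix (mat 1) 0 C E)"
proof -
  obtain E' where E': "E' ** E = mat 1"
    using assms unfolding invertible_def by blast
  have "- (E' ** C) + E' ** C = 0" by simp
  then have "block_matrix (mat 1) 0 (- (E' ** C)) E' ** block_matrix (mat 1) 0 C E = mat 1"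
    by (simp add: block_matrix_mult E' block_matrix_mat_1)
  then show ?thesis
    unfolding invertible_left_inverse by blast
qed

lemma posdef_scaleR:
  assumes "c > 0"
  shows "posdef (c *\<^sub>R A) \<longleftrightarrow> posdef A"
  using assms by (simp add: posdef_def transpose_scalar zero_less_mult_iff scaleR_matrix_vector_assoc[symmetric])

lemma matrix_mult_uminus_left: "(- A) ** B = - (A ** (B::real^'k^'n))" for A :: "real^'n^'m"
  by (simp add: vec_eq_iff matrix_matrix_mult_def sum_negf)

lemma matrix_mult_uminus_right: "A ** (- B) = - (A ** (B::real^'k^'n))" for A :: "real^'n^'m"
  by (simp add: vec_eq_iff matrix_matrix_mult_def sum_negf)

lemma matrix_sub_ldistrib: "A ** (B - C) = A ** B - A ** (C::real^'k^'n)" for A :: "real^'n^'m"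
  by (simp add: vec_eq_iff matrix_matrix_mult_def sum_subtractf right_diff_distrib)

lemma matrix_sub_rdistrib: "(A - B) ** C = A ** C - B ** (C::real^'k^'n)" for A :: "real^'n^'m"
  by (simp add: vec_eq_iff matrix_matrix_mult_def sum_subtractf left_diff_distrib)

lemma transpose_uminus: "transpose (- A) = - transpose (A::real^'n^'m)"
  by (simp add: vec_eq_iff transpose_def)

text \<open>Subtracting \<open>F\<close> times the first block row from the second, and likewise for
  columns, clears the off-diagonal blocks and leaves the Schur complement S - F S F'. The free
  factor \<open>E\<close> serves to normalize that complement later.\<close>

lemma iwar_scale_eliminate:
  fixes S F E :: "real^'q^'q"
  assumes "transpose S = S"
  shows "block_matrix (mat 1) 0 (- (E ** F)) E ** iwar_scale n F S ** transpose (block_matrix (mat 1) 0 (- (E ** F)) E)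
     = n *\<^sub>R block_matrix S 0 0 (E ** (S - F ** S ** transpose F) ** transpose E)"
  by (simp add: iwar_scale_def block_matrix_mult block_matrix_transpose matrix_scalar_ac assms
      matrix_transpose_mul matrix_mult_uminus_left matrix_mult_uminus_right transpose_uminus
      transpose_mat matrix_mul_assoc matrix_sub_ldistrib matrix_sub_rdistrib flip: scalar_matrix_assoc)

lemma posdef_congruence_iff:
  fixes A D :: "real^'m^'m"
  assumes "invertible A"
  shows "posdef (A ** D ** transpose A) \<longleftrightarrow> posdef D"
proof
  assume *: "posdef (A ** D ** transpose A)"
  obtain B where B: "A ** B = mat 1" "B ** A = mat 1"
    using assms(1) unfolding invertible_def by blast
  then have "invertible B" "transpose A ** transpose B = mat 1"
    by (auto simp: invertible_def simp flip: matrix_transpose_mul)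
  have "B ** (A ** D ** transpose A) ** transpose B = (B ** A) ** D ** (transpose A ** transpose B)"
    by (simp add: matrix_mul_assoc)
  also have "\<dots> = D" by (simp add: B \<open>transpose A ** transpose B = mat 1\<close>)
  finally show "posdef D"
    using posdef_congruence[OF \<open>invertible B\<close> *] by simp
qed (rule posdef_congruence[OF assms])

lemma inner_block_diag:
  fixes A B :: "real^'q^'q" and z :: "real^('q + 'q)"
  shows "z \<bullet> (block_matrix A 0 0 B *v z) =
    (\<chi> i. z $ Inl i) \<bullet> (A *v (\<chi> i. z $ Inl i)) + (\<chi> i. z $ Inr i) \<bullet> (B *v (\<chi> i. z $ Inr i))"
  by (simp add: inner_vec_def matrix_vector_mult_def sum_UNIV_sum_type)

lemma posdef_block_diag:
  fixes A B :: "real^'q^'q"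
  shows "posdef (block_matrix A 0 0 B) \<longleftrightarrow> posdef A \<and> posdef B"
proof (intro iffI conjI)
  assume *: "posdef (block_matrix A 0 0 B)"
  have "block_matrix (transpose A) 0 0 (transpose B) = block_matrix A 0 0 B"
    using posdefD_sym[OF *] by (simp add: block_matrix_transpose)
  then have sym: "transpose A = A" "transpose B = B"
    by (metis upper_block_matrix, metis lower_block_matrix)
  show "posdef A"
    unfolding posdef_def
  proof (intro conjI allI impI sym)
    fix x :: "real^'q" assume "x \<noteq> 0"
    \<comment> \<open>A vector supported on one block tests the form of that block alone.\<close>
    define z :: "real^('q + 'q)" where "z = (\<chi> a. case a of Inl i \<Rightarrow> x $ i | Inr i \<Rightarrow> 0)"
    have z: "(\<chi> i. z $ Inl i) = x" "(\<chi> i. z $ Inr i) = 0" by (simp_all add: z_def vec_eq_iff)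
    with \<open>x \<noteq> 0\<close> have "z \<noteq> 0" by (auto simp: vec_eq_iff split_sum_ex)
    from posdefD_pos[OF * this] show "0 < x \<bullet> (A *v x)"
      by (simp add: inner_block_diag z)
  qed
  show "posdef B"
    unfolding posdef_def
  proof (intro conjI allI impI sym)
    fix x :: "real^'q" assume "x \<noteq> 0"
    define z :: "real^('q + 'q)" where "z = (\<chi> a. case a of Inl i \<Rightarrow> 0 | Inr i \<Rightarrow> x $ i)"
    have z: "(\<chi> i. z $ Inl i) = 0" "(\<chi> i. z $ Inr i) = x" by (simp_all add: z_def vec_eq_iff)
    with \<open>x \<noteq> 0\<close> have "z \<noteq> 0" by (auto simp: vec_eq_iff split_sum_ex)
    from posdefD_pos[OF * this] show "0 < x \<bullet> (B *v x)"
      by (simp add: inner_block_diag z)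
  qed
next
  assume *: "posdef A \<and> posdef B"
  show "posdef (block_matrix A 0 0 B)"
    unfolding posdef_def
  proof (intro conjI allI impI)
    show "transpose (block_matrix A 0 0 B) = block_matrix A 0 0 B"
      using * by (simp add: block_matrix_transpose posdefD_sym)
    fix z :: "real^('q + 'q)" assume "z \<noteq> 0"
    define u v where "u = (\<chi> i. z $ Inl i)" and "v = (\<chi> i. z $ Inr i)"
    have "u \<noteq> 0 \<or> v \<noteq> 0"
      using \<open>z \<noteq> 0\<close> by (auto simp: u_def v_def vec_eq_iff split_sum_ex)
    moreover have "u \<bullet> (A *v u) \<ge> 0" "v \<bullet> (B *v v) \<ge> 0"
      using * posdefD_pos[of A u] posdefD_pos[of B v] by (cases "u = 0"; cases "v = 0"; force)+
    moreover have "u \<noteq> 0 \<Longrightarrow> u \<bullet> (A *v u) > 0" "v \<noteq> 0 \<Longrightarrow> v \<bullet> (B *v v) > 0"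
      using * posdefD_pos by blast+
    ultimately show "0 < z \<bullet> (block_matrix A 0 0 B *v z)"
      unfolding inner_block_diag u_def[symmetric] v_def[symmetric]
      by (smt (verit))
  qed
qed

text \<open>Elimination is a congruence by an invertible matrix, so positive definiteness can be
  read off the resulting block diagonal.\<close>

lemma posdef_iwar_scale_iff:
  fixes S F :: "real^'q^'q"
  assumes "n > 0" "transpose S = S"
  shows "posdef (iwar_scale n F S) \<longleftrightarrow> posdef S \<and> posdef (S - F ** S ** transpose F)"
proof -
  \<comment> \<open>This is the elimination with \<open>E = mat 1\<close>, written in the form in
    which \<open>iwar_scale_eliminate\<close> has it.\<close>
  have "invertible (block_matrix (mat 1) 0 (- (mat 1 ** F)) (mat 1))"
    by (rule block_triangular_invertible) (auto simp: invertible_def)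
  from posdef_congruence_iff[OF this, of "iwar_scale n F S"]
  show ?thesis
    unfolding iwar_scale_eliminate[OF assms(2)] using assms(1)
    by (simp add: posdef_scaleR posdef_block_diag)
qed

text \<open>Exchanging the blocks interchanges F S and S F'. To have the shape G S again, the new
  lower left block S F' forces G to be S F' times the inverse of S.\<close>

lemma swap_iwar_scale:
  fixes S F :: "real^'q^'q"
  assumes "posdef S"
  obtains G where "swap_matrix ** iwar_scale n F S ** transpose swap_matrix = iwar_scale n G S"
proof -
  have "invertible S"
    using posdef_det_pos[OF assms] by (simp add: invertible_det_nz)
  then obtain R where R: "S ** R = mat 1" "R ** S = mat 1"
    unfolding invertible_def by blast
  define G where "G = S ** transpose F ** R"
  have G: "G ** S = S ** transpose F"
    by (simp add: G_def R flip: matrix_mul_assoc)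
  have "S ** transpose G = F ** S"
    using arg_cong[OF G, of transpose] by (simp add: matrix_transpose_mul posdefD_sym[OF assms])
  with G that[of G] show thesis
    by (simp add: iwar_scale_def block_matrix_mult block_matrix_transpose
        matrix_scalar_ac flip: scalar_matrix_assoc)
qed

subsection \<open>Lebesgue measure on symmetric matrices\<close>

text \<open>
  Invariance is only required under \<open>H\<close>, because measures on the symmetric matrices are here
  measures on all matrices that are concentrated on \<open>H\<close>.  The proof evaluates the double integral of
  \<open>1\<^sub>K x * g (y + x)\<close> in both orders.
\<close>

lemma haar_measure_unique:
  fixes \<mu> \<nu> :: "'a::{real_normed_vector, second_countable_topology} measure"
  assumes "sigma_finite_measure \<mu>" "sigma_finite_measure \<nu>"
    and sets[measurable_cong]: "sets \<mu> = sets borel" "sets \<nu> = sets borel"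
    and AE: "AE x in \<mu>. x \<in> H" "AE x in \<nu>. x \<in> H"
    and uminus_H: "\<And>h. h \<in> H \<Longrightarrow> - h \<in> H"
    and inv\<mu>: "\<And>h. h \<in> H \<Longrightarrow> distr \<mu> borel (\<lambda>x. x + h) = \<mu>"
    and inv\<nu>: "\<And>h. h \<in> H \<Longrightarrow> distr \<nu> borel (\<lambda>x. x + h) = \<nu>"
    and K[measurable]: "K \<in> sets borel" and uminus_K: "\<And>x. - x \<in> K \<longleftrightarrow> x \<in> K"
    and \<mu>K: "0 < emeasure \<mu> K" "emeasure \<mu> K < \<infinity>"
    and \<nu>K: "0 < emeasure \<nu> K" "emeasure \<nu> K < \<infinity>"
  obtains c where "0 < c" "c < \<infinity>" "\<nu> = density \<mu> (\<lambda>_. c)"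
proof -
  interpret pair_sigma_finite \<mu> \<nu>
    using assms(1,2) by (simp add: pair_sigma_finite_def)
  have int\<mu>: "(\<integral>\<^sup>+x. \<phi> (x + h) \<partial>\<mu>) = (\<integral>\<^sup>+x. \<phi> x \<partial>\<mu>)" if "h \<in> H" "\<phi> \<in> borel_measurable borel" for h \<phi>
    by (subst inv\<mu>[OF that(1), symmetric], subst nn_integral_distr) (use that in auto)
  have int\<nu>: "(\<integral>\<^sup>+x. \<phi> (x + h) \<partial>\<nu>) = (\<integral>\<^sup>+x. \<phi> x \<partial>\<nu>)" if "h \<in> H" "\<phi> \<in> borel_measurable borel" for h \<phi>
    by (subst inv\<nu>[OF that(1), symmetric], subst nn_integral_distr) (use that in auto)
  define f :: "'a \<Rightarrow> ennreal" where "f = indicator K"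
  have [measurable]: "f \<in> borel_measurable borel" by (simp add: f_def)
  have f_uminus: "f (- x) = f x" for x
    by (auto simp: f_def uminus_K indicator_def)
  have *: "emeasure \<mu> K * (\<integral>\<^sup>+y. g y \<partial>\<nu>) = emeasure \<nu> K * (\<integral>\<^sup>+x. g x \<partial>\<mu>)"
    if g[measurable]: "g \<in> borel_measurable borel" for g :: "'a \<Rightarrow> ennreal"
  proof -
    have "emeasure \<mu> K * (\<integral>\<^sup>+y. g y \<partial>\<nu>) = (\<integral>\<^sup>+x. f x * (\<integral>\<^sup>+y. g y \<partial>\<nu>) \<partial>\<mu>)"
      by (subst nn_integral_multc) (simp_all add: f_def)
    also have "\<dots> = (\<integral>\<^sup>+x. (\<integral>\<^sup>+y. f x * g (y + x) \<partial>\<nu>) \<partial>\<mu>)"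
      by (rule nn_integral_cong_AE, use AE(1) in eventually_elim)
         (simp add: int\<nu> nn_integral_cmult)
    also have "\<dots> = (\<integral>\<^sup>+y. (\<integral>\<^sup>+x. f x * g (y + x) \<partial>\<mu>) \<partial>\<nu>)"
      by (rule Fubini'[symmetric]) simp
    \<comment> \<open>Translation of \<open>x\<close> by \<open>- y\<close>, which lies in
      \<open>H\<close> for almost every \<open>y\<close>.\<close>
    also have "\<dots> = (\<integral>\<^sup>+y. (\<integral>\<^sup>+x. f (x - y) * g x \<partial>\<mu>) \<partial>\<nu>)"
    proof (rule nn_integral_cong_AE, use AE(2) in eventually_elim)
      case (elim y)
      show ?case
        using int\<mu>[OF uminus_H[OF elim], of "\<lambda>x. f x * g (y + x)"] by simp
    qed
    also have "\<dots> = (\<integral>\<^sup>+x. (\<integral>\<^sup>+y. f (x - y) * g x \<partial>\<nu>) \<partial>\<mu>)"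
      by (rule Fubini') simp
    also have "\<dots> = (\<integral>\<^sup>+x. emeasure \<nu> K * g x \<partial>\<mu>)"
    proof (rule nn_integral_cong_AE, use AE(1) in eventually_elim)
      case (elim x)
      have "(\<integral>\<^sup>+y. f (x - y) * g x \<partial>\<nu>) = (\<integral>\<^sup>+y. f (x - y) \<partial>\<nu>) * g x"
        by (rule nn_integral_multc) simp
      \<comment> \<open>Translating \<open>y\<close> by \<open>x\<close> turns \<open>x - y\<close>
        into \<open>- y\<close>, and \<open>f\<close> is even because \<open>K\<close> is
        symmetric.\<close>
      also have "(\<integral>\<^sup>+y. f (x - y) \<partial>\<nu>) = (\<integral>\<^sup>+y. f y \<partial>\<nu>)"
        using int\<nu>[OF elim, of "\<lambda>y. f (x - y)"] by (simp add: f_uminus)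
      also have "\<dots> = emeasure \<nu> K" by (simp add: f_def)
      finally show ?case .
    qed
    also have "\<dots> = emeasure \<nu> K * (\<integral>\<^sup>+x. g x \<partial>\<mu>)"
      by (rule nn_integral_cmult) simp
    finally show ?thesis .
  qed
  define c where "c = emeasure \<nu> K / emeasure \<mu> K"
  have "\<nu> = density \<mu> (\<lambda>_. c)"
  proof (rule measure_eqI)
    fix A assume "A \<in> sets \<nu>"
    then have A[measurable]: "A \<in> sets borel" by (simp add: sets)
    have "emeasure \<mu> K * emeasure \<nu> A = emeasure \<nu> K * emeasure \<mu> A"
      using *[of "indicator A"] by (simp add: sets)
    then have "emeasure \<nu> A = emeasure \<nu> K * emeasure \<mu> A / emeasure \<mu> K"
      using \<mu>K by (metis ennreal_mult_divide_eq infinity_ennreal_def mult.commute order_less_irrefl)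
    also have "\<dots> = c * emeasure \<mu> A"
      unfolding c_def by (simp add: divide_ennreal_def mult_ac)
    finally show "emeasure \<nu> A = emeasure (density \<mu> (\<lambda>_. c)) A"
      by (simp add: emeasure_density nn_integral_cmult sets)
  qed (simp add: sets)
  moreover have "0 < c" "c < \<infinity>"
    using \<mu>K \<nu>K unfolding c_def
    by (auto simp: ennreal_zero_less_divide ennreal_divide_eq_top_iff less_top[symmetric])
  ultimately show thesis by (rule that[rotated -1])
qed

lemma sigma_finite_measure_cball:
  fixes M :: "'a::real_normed_vector measure"
  assumes sets: "sets M = sets borel" and fin: "\<And>r. emeasure M (cball 0 r) < \<infinity>"
  shows "sigma_finite_measure M"
proof
  show "\<exists>A. countable A \<and> A \<subseteq> sets M \<and> \<Union>A = space M \<and> (\<forall>a\<in>A. emeasure M a \<noteq> \<infinity>)"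
  proof (intro exI[of _ "range (\<lambda>n::nat. cball 0 (real n))"] conjI ballI)
    show "\<Union> (range (\<lambda>n::nat. cball 0 (real n))) = space M"
      using sets_eq_imp_space_eq[OF sets] real_arch_simple by auto
  next
    fix a assume "a \<in> range (\<lambda>n::nat. cball (0::'a) (real n))"
    then obtain n :: nat where "a = cball 0 (real n)" by blast
    then show "emeasure M a \<noteq> \<infinity>" using fin[of "real n"] by simp
  qed (auto simp: sets)
qed

section \<open>Translation invariance of Lebesgue measure on symmetric matrices, and its values on
  balls\<close>

lemma PiM_lborel_translation:
  fixes b :: "'i \<Rightarrow> real"
  assumes "finite I"
  shows "distr (Pi\<^sub>M I (\<lambda>_. lborel)) (Pi\<^sub>M I (\<lambda>_. lborel)) (\<lambda>x. \<lambda>i\<in>I. x i + b i) = Pi\<^sub>M I (\<lambda>_. lborel)"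
proof -
  interpret product_sigma_finite "\<lambda>_::'i. lborel :: real measure" ..
  show ?thesis
  proof (rule PiM_eqI[OF assms])
    fix A :: "'i \<Rightarrow> real set" assume A: "\<And>i. i \<in> I \<Longrightarrow> A i \<in> sets lborel"
    have A': "(\<lambda>x. x + b i) -` A i \<in> sets borel" if "i \<in> I" for i
      using A[OF that] measurable_sets[of "\<lambda>x. x + b i" borel borel "A i"] by simp
    have 1: "Pi\<^sub>E I A \<in> sets (Pi\<^sub>M I (\<lambda>_. lborel))"
      using A assms by (intro sets_PiM_I_finite) auto
    have 2: "(\<lambda>x. \<lambda>i\<in>I. x i + b i) \<in> Pi\<^sub>M I (\<lambda>_. lborel) \<rightarrow>\<^sub>M Pi\<^sub>M I (\<lambda>_. lborel)"
      by (rule measurable_restrict) measurable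
    have "(\<lambda>x. \<lambda>i\<in>I. x i + b i) -` Pi\<^sub>E I A \<inter> space (Pi\<^sub>M I (\<lambda>_. lborel)) = (\<Pi>\<^sub>E i\<in>I. (\<lambda>x. x + b i) -` A i)"
      by (auto simp: space_PiM PiE_def Pi_def)
    then have "emeasure (distr (Pi\<^sub>M I (\<lambda>_. lborel)) (Pi\<^sub>M I (\<lambda>_. lborel)) (\<lambda>x. \<lambda>i\<in>I. x i + b i)) (Pi\<^sub>E I A)
        = (\<Prod>i\<in>I. emeasure lborel ((\<lambda>x. x + b i) -` A i))"
      using A' by (simp add: emeasure_distr[OF 2 1] emeasure_PiM[OF assms])
    also have "\<dots> = (\<Prod>i\<in>I. emeasure lborel (A i))"
    proof (rule prod.cong[OF refl])
      fix i assume "i \<in> I"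
      have "emeasure lborel (A i) = emeasure (distr lborel borel (\<lambda>x. b i + x)) (A i)"
        by (simp add: lborel_distr_plus)
      also have "\<dots> = emeasure lborel ((\<lambda>x. x + b i) -` A i)"
        using A[OF \<open>i \<in> I\<close>] by (subst emeasure_distr) (auto simp: add.commute intro!: arg_cong[where f = "emeasure lborel"])
      finally show "emeasure lborel ((\<lambda>x. x + b i) -` A i) = emeasure lborel (A i)" by simp
    qed
    finally show "emeasure (distr (Pi\<^sub>M I (\<lambda>_. lborel)) (Pi\<^sub>M I (\<lambda>_. lborel)) (\<lambda>x. \<lambda>i\<in>I. x i + b i)) (Pi\<^sub>E I A)
        = (\<Prod>i\<in>I. emeasure lborel (A i))" .
  qed simp
qed

lemma borel_measurable_matrixI:
  fixes f :: "'a \<Rightarrow> real^'n^'m"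
  assumes "\<And>i j. (\<lambda>x. f x $ i $ j) \<in> borel_measurable M"
  shows "f \<in> borel_measurable M"
proof (subst borel_measurable_euclidean_space, rule ballI)
  fix b :: "real^'n^'m" assume "b \<in> Basis"
  then obtain i j where "b = axis i (axis j 1)"
    by (auto simp: Basis_vec_def)
  then show "(\<lambda>x. f x \<bullet> b) \<in> borel_measurable M"
    using assms[of i j] by (simp add: inner_axis)
qed

lemma borel_measurable_matrix_nth [measurable]:
  "(\<lambda>X::real^'n^'m. X $ i $ j) \<in> borel_measurable borel"
  by (intro borel_measurable_continuous_onI continuous_intros)

abbreviation sym_index :: "'m set set" where
  "sym_index \<equiv> {{i, j} |i j. True}"

abbreviation sym_embed :: "('m::finite set \<Rightarrow> real) \<Rightarrow> real^'m^'m" where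
  "sym_embed \<equiv> \<lambda>x. \<chi> i j. x {i, j}"

lemma finite_sym_index: "finite (sym_index :: 'm::finite set set)"
  by (rule finite)

lemma sym_embed_measurable [measurable]:
  "(sym_embed :: ('m::finite set \<Rightarrow> real) \<Rightarrow> _) \<in> Pi\<^sub>M sym_index (\<lambda>_. lborel) \<rightarrow>\<^sub>M borel"
proof (rule borel_measurable_matrixI)
  fix i j :: 'm
  have "(\<lambda>x. x {i, j}) \<in> Pi\<^sub>M sym_index (\<lambda>_. lborel) \<rightarrow>\<^sub>M lborel"
    by (rule measurable_component_singleton) auto
  then show "(\<lambda>x. sym_embed x $ i $ j) \<in> borel_measurable (Pi\<^sub>M sym_index (\<lambda>_. lborel))"
    by simp
qed

lemma sets_sym_lborel [simp, measurable_cong]: "sets sym_lborel = sets borel"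
  and space_sym_lborel [simp]: "space sym_lborel = UNIV"
  by (simp_all add: sym_lborel_def)

lemma closed_symmetric: "closed {X::real^'m^'m. transpose X = X}"
proof -
  have "{X::real^'m^'m. transpose X = X} = (\<Inter>i. \<Inter>j. {X. X $ j $ i = X $ i $ j})"
    by (auto simp: vec_eq_iff transpose_def)
  also have "closed \<dots>"
    by (intro closed_INT ballI closed_Collect_eq continuous_intros)
  finally show ?thesis .
qed

lemma AE_sym_lborel: "AE X in sym_lborel. transpose X = X"
  unfolding sym_lborel_def
proof (subst AE_distr_iff[OF sym_embed_measurable])
  show "{X \<in> space borel. transpose X = X} \<in> sets (borel :: (real^'a^'a) measure)"
    using borel_closed[OF closed_symmetric] by simp
  have "transpose (sym_embed x) = sym_embed x" for x :: "'a set \<Rightarrow> real"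
    by (simp add: transpose_def insert_commute)
  then show "AE x in Pi\<^sub>M sym_index (\<lambda>_. lborel). transpose (sym_embed x) = (sym_embed x :: real^'a^'a)"
    by (rule AE_I2)
qed

lemma sym_lborel_translation:
  fixes B :: "real^'m^'m"
  assumes "transpose B = B"
  shows "distr sym_lborel borel (\<lambda>X. X + B) = sym_lborel"
proof -
  \<comment> \<open>\<open>b\<close> reads the matrix \<open>B\<close> as a function of unordered
    pairs; the choice is unambiguous because \<open>B\<close> is symmetric.\<close>
  define b where "b e = (SOME r. \<exists>i j. e = {i, j} \<and> r = B $ i $ j)" for e
  have sym: "B $ j $ i = B $ i $ j" for i j
    using assms by (metis transpose_def vec_lambda_beta)
  have b: "b {i, j} = B $ i $ j" for i j
    unfolding b_def by (rule some1_equality) (auto simp: doubleton_eq_iff sym)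
  let ?P = "Pi\<^sub>M sym_index (\<lambda>_. lborel) :: ('m set \<Rightarrow> real) measure"
  let ?t = "\<lambda>x. \<lambda>e\<in>sym_index. x e + b e"
  have "?t \<in> ?P \<rightarrow>\<^sub>M ?P"
    by (rule measurable_restrict) measurable
  then have "distr ?P borel (sym_embed \<circ> ?t) = distr (distr ?P ?P ?t) borel sym_embed"
    by (rule distr_distr[OF sym_embed_measurable, symmetric])
  also have "\<dots> = sym_lborel"
    by (simp add: PiM_lborel_translation sym_lborel_def)
  also have "sym_embed \<circ> ?t = (\<lambda>x. sym_embed x + B)"
  proof -
    have "{i, j} \<in> sym_index" for i j :: 'm by blast
    then show ?thesis by (auto simp: fun_eq_iff vec_eq_iff b)
  qed
  finally show ?thesis
    unfolding sym_lborel_def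
    by (subst distr_distr[OF _ sym_embed_measurable]) (auto simp only: comp_def intro!: borel_measurable_add measurable_ident_sets borel_measurable_const)
qed

lemma emeasure_PiM_lborel_cube:
  assumes "finite I" "r \<ge> 0"
  shows "emeasure (Pi\<^sub>M I (\<lambda>_. lborel)) (\<Pi>\<^sub>E i\<in>I. {-r..r}) = ennreal ((2 * r) ^ card I)"
proof -
  interpret product_sigma_finite "\<lambda>_::'a. lborel :: real measure" ..
  show ?thesis
    using assms by (simp add: emeasure_PiM ennreal_power)
qed

lemma norm_matrix_le:
  fixes X :: "real^'n^'m"
  assumes "\<And>i j. \<bar>X $ i $ j\<bar> \<le> r"
  shows "norm X \<le> real (CARD('m) * CARD('n)) * r"
proof -
  have "norm X \<le> (\<Sum>i\<in>UNIV. norm (X $ i))"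
    by (simp add: norm_vec_def L2_set_le_sum)
  also have "\<dots> \<le> (\<Sum>i\<in>(UNIV::'m set). \<Sum>j\<in>(UNIV::'n set). r)"
    using assms by (intro sum_mono order_trans[OF norm_le_l1_cart]) auto
  finally show ?thesis by simp
qed

text \<open>In coordinates a ball lies between two cubes: each entry is bounded by the norm, and the
  norm by the number of entries times their largest modulus. The bounds give sigma-finiteness, and
  they make the unit ball a valid reference set for \<open>haar_measure_unique\<close>.\<close>

lemma emeasure_sym_lborel_cball:
  "emeasure (sym_lborel :: (real^'m^'m) measure) (cball 0 r) < \<infinity>"
  "r > 0 \<Longrightarrow> 0 < emeasure (sym_lborel :: (real^'m^'m) measure) (cball 0 r)"
proof -
  let ?P = "Pi\<^sub>M sym_index (\<lambda>_. lborel) :: ('m set \<Rightarrow> real) measure"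
  have eq: "emeasure (sym_lborel :: (real^'m^'m) measure) (cball 0 r)
      = emeasure ?P (sym_embed -` cball 0 r \<inter> space ?P)" for r
    unfolding sym_lborel_def by (rule emeasure_distr[OF sym_embed_measurable]) simp
  have cube: "(\<Pi>\<^sub>E i\<in>sym_index. {-r..r}) \<in> sets ?P" for r
    by (rule sets_PiM_I_finite) auto
  have pre: "sym_embed -` cball 0 r \<inter> space ?P \<in> sets ?P" for r
    by (rule measurable_sets[OF sym_embed_measurable]) simp
  have *: "\<bar>x {i, j}\<bar> \<le> r" if "sym_embed x \<in> cball 0 r" for x :: "'m set \<Rightarrow> real" and i j r
  proof -
    have "\<bar>x {i, j}\<bar> = \<bar>sym_embed x $ i $ j\<bar>" by simp
    also have "\<dots> \<le> norm (sym_embed x)"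
      by (rule order_trans[OF component_le_norm_cart Finite_Cartesian_Product.norm_nth_le])
    finally show ?thesis using that by simp
  qed
  \<comment> \<open>The modulus of \<open>r\<close> covers negative radii, for which the ball is
    empty, while the cube formula needs a nonnegative side.\<close>
  have "sym_embed -` cball 0 r \<inter> space ?P \<subseteq> (\<Pi>\<^sub>E i\<in>sym_index. {-\<bar>r\<bar>..\<bar>r\<bar>})"
  proof
    fix x :: "'m set \<Rightarrow> real" assume x: "x \<in> sym_embed -` cball 0 r \<inter> space ?P"
    have "x {i, j} \<in> {-\<bar>r\<bar>..\<bar>r\<bar>}" for i j
      using *[of x r i j] x by auto
    moreover have "x \<in> extensional sym_index"
      using x by (simp only: Int_iff space_PiM PiE_def)
    ultimately show "x \<in> (\<Pi>\<^sub>E i\<in>sym_index. {-\<bar>r\<bar>..\<bar>r\<bar>})"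
      unfolding PiE_def Pi_def by blast
  qed
  from emeasure_mono[OF this cube]
  show "emeasure (sym_lborel :: (real^'m^'m) measure) (cball 0 r) < \<infinity>"
    unfolding eq
    by (subst (asm) emeasure_PiM_lborel_cube[OF finite_sym_index]) (simp_all add: order_le_less_trans)
  assume "r > 0"
  \<comment> \<open>The side for which \<open>norm_matrix_le\<close> bounds the norm by exactly
    \<open>r\<close>.\<close>
  define e where "e = r / real (CARD('m) * CARD('m))"
  have "e > 0" using \<open>r > 0\<close> by (simp add: e_def)
  have "(\<Pi>\<^sub>E i\<in>sym_index. {-e..e}) \<subseteq> sym_embed -` cball 0 r \<inter> space ?P"
  proof
    fix x :: "'m set \<Rightarrow> real" assume x: "x \<in> (\<Pi>\<^sub>E i\<in>sym_index. {-e..e})"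
    have "x {i, j} \<in> {-e..e}" for i j
      by (rule PiE_mem[OF x]) blast
    then have "\<bar>sym_embed x $ i $ j\<bar> \<le> e" for i j
      by (auto simp: abs_le_iff minus_le_iff)
    from norm_matrix_le[of "sym_embed x", OF this]
    have "norm (sym_embed x) \<le> r" by (simp add: e_def)
    then show "x \<in> sym_embed -` cball 0 r \<inter> space ?P"
      using x by (simp add: space_PiM PiE_def)
  qed
  from emeasure_mono[OF this pre]
  have "ennreal ((2 * e) ^ card (sym_index :: 'm set set)) \<le> emeasure (sym_lborel :: (real^'m^'m) measure) (cball 0 r)"
    unfolding eq using \<open>e > 0\<close>
    by (subst (asm) emeasure_PiM_lborel_cube[OF finite_sym_index]) simp_all
  moreover have "0 < ennreal ((2 * e) ^ card (sym_index :: 'm set set))"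
    using \<open>e > 0\<close> by (simp only: ennreal_less_zero_iff zero_less_power mult_pos_pos zero_less_numeral)
  ultimately show "0 < emeasure (sym_lborel :: (real^'m^'m) measure) (cball 0 r)"
    by (rule order_less_le_trans[rotated])
qed

lemma sigma_finite_sym_lborel: "sigma_finite_measure sym_lborel"
  by (rule sigma_finite_measure_cball[OF sets_sym_lborel emeasure_sym_lborel_cball(1)])


section \<open>The image of Lebesgue measure on symmetric matrices under a congruence\<close>

lemma matrix_mult_add_rdistrib: "(A + B) ** C = A ** C + B ** (C::real^'k^'n)" for A :: "real^'n^'m"
  by (simp add: vec_eq_iff matrix_matrix_mult_def sum.distrib distrib_right)

lemma bounded_linear_congruence: "bounded_linear (\<lambda>X::real^'m^'m. A ** X ** B)"
  by (rule linear_conv_bounded_linear[THEN iffD1], rule linearI)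
     (simp_all add: matrix_add_ldistrib matrix_mult_add_rdistrib matrix_scalar_ac flip: scalar_matrix_assoc)

lemma congruence_measurable [measurable]:
  "(\<lambda>X::real^'m^'m. A ** X ** B) \<in> borel_measurable borel"
  by (intro borel_measurable_continuous_onI linear_continuous_on bounded_linear_congruence)

text \<open>X -> A X A' is a linear bijection of the symmetric matrices, so the image measure is
  again invariant under symmetric translations. It is finite on balls and positive on the unit ball,
  hence a constant multiple of the original by \<open>haar_measure_unique\<close>.\<close>

lemma distr_sym_lborel_congruence:
  fixes A :: "real^'m^'m"
  assumes "invertible A"
  obtains c where "0 < c" "c < \<infinity>"
    "distr sym_lborel borel (\<lambda>X. A ** X ** transpose A) = density sym_lborel (\<lambda>_. c)"
proof -
  obtain B where B: "A ** B = mat 1" "B ** A = mat 1"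
    using assms(1) unfolding invertible_def by blast
  have tB: "transpose A ** transpose B = mat 1" "transpose B ** transpose A = mat 1"
    using B by (simp_all flip: matrix_transpose_mul)
  define T T' where "T = (\<lambda>X. A ** X ** transpose A)" and "T' = (\<lambda>X. B ** X ** transpose B)"
  have T'T: "T' (T X) = X" for X
  proof -
    have "T' (T X) = (B ** A) ** X ** (transpose A ** transpose B)"
      by (simp add: T_def T'_def matrix_mul_assoc)
    then show ?thesis by (simp add: B tB)
  qed
  have TT': "T (T' X) = X" for X
  proof -
    have "T (T' X) = (A ** B) ** X ** (transpose B ** transpose A)"
      by (simp add: T_def T'_def matrix_mul_assoc)
    then show ?thesis by (simp add: B tB)
  qed
  have T_sym: "transpose (T X) = T X" if "transpose X = X" for X
    using that by (simp add: T_def matrix_transpose_mul matrix_mul_assoc)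
  have T'_sym: "transpose (T' X) = T' X" if "transpose X = X" for X
    using that by (simp add: T'_def matrix_transpose_mul matrix_mul_assoc)
  have T_add: "T (X + Y) = T X + T Y" for X Y
    by (simp add: T_def matrix_add_ldistrib matrix_mult_add_rdistrib)
  have T[measurable]: "T \<in> borel_measurable borel"
    unfolding T_def by measurable
  let ?\<nu> = "distr sym_lborel borel T"
  have emeasure_\<nu>: "emeasure ?\<nu> K = emeasure sym_lborel (T -` K)" if "K \<in> sets borel" for K
    using that by (simp add: emeasure_distr)
  have meas: "T -` cball 0 r \<in> sets sym_lborel" for r
    using measurable_sets[OF T, of "cball 0 r"] by simp
  have finite_\<nu>: "emeasure ?\<nu> (cball 0 r) < \<infinity>" for r
  proof -
    \<comment> \<open>Boundedness of the inverse map puts the preimage of a ball inside a ball;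
      below, boundedness of \<open>T\<close> puts a ball inside the preimage.\<close>
    obtain k where k: "k > 0" "\<And>X. norm (T' X) \<le> norm X * k"
      using bounded_linear.pos_bounded[OF bounded_linear_congruence] unfolding T'_def by blast
    have "T -` cball 0 r \<subseteq> cball 0 (r * k)"
    proof
      fix X assume "X \<in> T -` cball 0 r"
      then have "norm (T X) * k \<le> r * k" using k(1) by simp
      with k(2)[of "T X"] show "X \<in> cball 0 (r * k)" by (simp add: T'T)
    qed
    from emeasure_mono[OF this, of sym_lborel] show ?thesis
      by (subst emeasure_\<nu>) (use emeasure_sym_lborel_cball(1)[of "r * k"] in \<open>auto intro: order_le_less_trans\<close>)
  qed
  have pos_\<nu>: "0 < emeasure ?\<nu> (cball 0 1)"
  proof -
    obtain k where k: "k > 0" "\<And>X. norm (T X) \<le> norm X * k"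
      using bounded_linear.pos_bounded[OF bounded_linear_congruence] unfolding T_def by blast
    have "cball 0 (1 / k) \<subseteq> T -` cball 0 1"
    proof
      fix X :: "real^'m^'m" assume "X \<in> cball 0 (1 / k)"
      then have "norm X * k \<le> 1" using k(1) by (simp add: field_simps)
      with k(2)[of X] show "X \<in> T -` cball 0 1" by simp
    qed
    from emeasure_mono[OF this meas] show ?thesis
      using emeasure_sym_lborel_cball(2)[of "1 / k"] k(1)
      by (subst emeasure_\<nu>) (auto intro: order_less_le_trans)
  qed
  have inv: "distr ?\<nu> borel (\<lambda>X. X + C) = ?\<nu>" if "transpose C = C" for C
  proof -
    \<comment> \<open>Translating by \<open>C\<close> after \<open>T\<close> is translating by the
      symmetric matrix \<open>T' C\<close> before it.\<close>
    have "distr ?\<nu> borel (\<lambda>X. X + C) = distr sym_lborel borel (\<lambda>X. T (X + T' C))"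
      by (subst distr_distr) (auto simp: comp_def T_add TT')
    also have "\<dots> = distr (distr sym_lborel borel (\<lambda>X. X + T' C)) borel T"
      by (subst distr_distr) (auto simp: comp_def)
    also have "\<dots> = ?\<nu>"
      by (simp add: sym_lborel_translation T'_sym that)
    finally show ?thesis .
  qed
  have AE_\<nu>: "AE X in ?\<nu>. X \<in> {X. transpose X = X}"
  proof (subst AE_distr_iff)
    show "{X \<in> space borel. X \<in> {X. transpose X = X}} \<in> sets (borel :: (real^'m^'m) measure)"
      using borel_closed[OF closed_symmetric] by simp
    show "AE X in sym_lborel. T X \<in> {X. transpose X = X}"
      using AE_sym_lborel by eventually_elim (simp add: T_sym)
  qed simp
  have AE_sym: "AE X in sym_lborel. X \<in> {X. transpose X = X}"
    using AE_sym_lborel by simp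
  have uminus_sym: "- h \<in> {X. transpose X = X}" if "h \<in> {X. transpose X = X}" for h :: "real^'m^'m"
    using that by (simp add: transpose_uminus)
  obtain c where "0 < c" "c < \<infinity>" "?\<nu> = density sym_lborel (\<lambda>_. c)"
    by (rule haar_measure_unique[OF sigma_finite_sym_lborel
          sigma_finite_measure_cball[OF sets_distr finite_\<nu>] sets_sym_lborel sets_distr
          AE_sym AE_\<nu> uminus_sym, of "cball 0 1"])
       (simp_all add: sym_lborel_translation inv finite_\<nu>[simplified] pos_\<nu> emeasure_sym_lborel_cball[simplified])
  then show thesis
    using that unfolding T_def by blast
qed

subsection \<open>Congruence of inverse Wishart matrices\<close>

text \<open>The quadratic form attains a positive minimum on the compact unit sphere, and scaling
  carries the bound to all vectors. A natural number as constant turns the existential into a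
  countable union, as measurability requires.\<close>

lemma posdef_iff_uniformly_positive:
  fixes X :: "real^'m^'m"
  shows "posdef X \<longleftrightarrow> transpose X = X \<and> (\<exists>k::nat. \<forall>x. (norm x)\<^sup>2 \<le> real k * (x \<bullet> (X *v x)))"
proof (intro iffI conjI; (elim conjE exE)?)
  assume X: "posdef X"
  show "transpose X = X" by (rule posdefD_sym[OF X])
  let ?f = "\<lambda>x. x \<bullet> (X *v x)"
  have "continuous_on (sphere 0 1) ?f"
    by (intro continuous_on_inner continuous_on_id matrix_vector_mult_linear_continuous_on)
  moreover have "axis (undefined::'m) 1 \<in> sphere (0::real^'m) 1"
    by simp
  ultimately obtain u where u: "u \<in> sphere 0 1" "\<And>x. x \<in> sphere 0 1 \<Longrightarrow> ?f u \<le> ?f x"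
    using continuous_attains_inf[OF compact_sphere, of "0::real^'m" 1 ?f] by blast
  have "?f u > 0"
    using u(1) by (intro posdefD_pos[OF X]) auto
  then obtain k :: nat where k: "1 < real k * ?f u"
    using reals_Archimedean3 by blast
  have "(norm x)\<^sup>2 \<le> real k * ?f x" for x
  proof (cases "x = 0")
    case False
    define y where "y = (1 / norm x) *\<^sub>R x"
    have "?f u \<le> ?f y" using False by (intro u) (simp add: y_def)
    also have "?f y = ?f x / (norm x)\<^sup>2"
      by (simp add: y_def matrix_vector_mult_scaleR power2_eq_square)
    finally have "?f u * (norm x)\<^sup>2 \<le> ?f x" using False by (simp add: field_simps)
    then have "real k * (?f u * (norm x)\<^sup>2) \<le> real k * ?f x" by (intro mult_left_mono) auto
    moreover have "1 * (norm x)\<^sup>2 \<le> real k * ?f u * (norm x)\<^sup>2"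
      using k by (intro mult_right_mono) auto
    ultimately show ?thesis by (simp add: mult_ac)
  qed simp
  then show "\<exists>k::nat. \<forall>x. (norm x)\<^sup>2 \<le> real k * ?f x" by blast
next
  fix k :: nat
  assume X: "transpose X = X" "\<forall>x. (norm x)\<^sup>2 \<le> real k * (x \<bullet> (X *v x))"
  show "posdef X"
    unfolding posdef_def
  proof (intro conjI allI impI X(1))
    fix x :: "real^'m" assume "x \<noteq> 0"
    \<comment> \<open>The squared norm is positive, so the product is too; this also excludes
      \<open>k = 0\<close>.\<close>
    then have "0 < real k * (x \<bullet> (X *v x))"
      using X(2) by (meson less_le_trans zero_less_norm_iff zero_less_power)
    then show "0 < x \<bullet> (X *v x)"
      by (simp add: zero_less_mult_iff)
  qed
qed

text \<open>For fixed \<open>k\<close> the condition is an uncountable intersection of closed sets,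
  hence closed; only the union over \<open>k\<close> has to be countable.\<close>

lemma posdef_borel: "{X::real^'m^'m. posdef X} \<in> sets borel"
proof -
  have "{X::real^'m^'m. posdef X} = {X. transpose X = X} \<inter>
      (\<Union>k::nat. \<Inter>x. {X. (norm x)\<^sup>2 \<le> real k * (x \<bullet> (X *v x))})"
    unfolding posdef_iff_uniformly_positive by auto
  also have "\<dots> \<in> sets borel"
  proof (rule sets.Int)
    have "closed {X::real^'m^'m. (norm x)\<^sup>2 \<le> real k * (x \<bullet> (X *v x))}" for k :: nat and x :: "real^'m"
      unfolding inner_vec_def matrix_vector_mult_def
      by (intro closed_Collect_le continuous_intros)
    then show "(\<Union>k::nat. \<Inter>x. {X::real^'m^'m. (norm x)\<^sup>2 \<le> real k * (x \<bullet> (X *v x))}) \<in> sets borel"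
      by (intro sets.countable_UN borel_closed closed_INT ballI image_subsetI)
  qed (rule borel_closed[OF closed_symmetric])
  finally show ?thesis .
qed

lemma det_measurable [measurable]:
  assumes "\<And>i j. (\<lambda>x. f x $ i $ j) \<in> borel_measurable M"
  shows "(\<lambda>x. det (f x) :: real) \<in> borel_measurable M"
  unfolding det_def using assms
  by (intro borel_measurable_sum borel_measurable_times borel_measurable_const borel_measurable_prod)

text \<open>Cramer's rule. It replaces the choice-based \<open>matrix_inv\<close> by quotients of
  determinants, whose measurability is clear.\<close>

lemma trace_matrix_inv_mult:
  fixes X D :: "real^'m^'m"
  assumes "det X \<noteq> 0"
  shows "trace (matrix_inv X ** D) =
    (\<Sum>k\<in>UNIV. \<Sum>l\<in>UNIV. det (\<chi> i j. if j = k then (axis l 1 :: real^'m) $ i else X $ i $ j) / det X * D $ l $ k)"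
proof -
  obtain Y where Y: "X ** Y = mat 1"
    using assms by (metis invertible_det_nz invertible_right_inverse)
  have "Y $ k $ l = det (\<chi> i j. if j = k then (axis l 1 :: real^'m) $ i else X $ i $ j) / det X" for k l
  proof -
    have "X *v (Y *v axis l 1) = axis l 1"
      by (simp add: matrix_vector_mul_assoc Y)
    then have "Y *v axis l 1 = (\<chi> k. det (\<chi> i j. if j = k then (axis l 1 :: real^'m) $ i else X $ i $ j) / det X)"
      by (simp only: cramer[OF assms])
    then have "(Y *v axis l 1) $ k = det (\<chi> i j. if j = k then (axis l 1 :: real^'m) $ i else X $ i $ j) / det X"
      by simp
    moreover have "(Y *v axis l 1) $ k = Y $ k $ l"
      by (simp add: matrix_vector_mult_basis column_def)
    ultimately show ?thesis by simp
  qed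
  then show ?thesis
    by (simp add: matrix_inv_eqI[OF Y] trace_def matrix_matrix_mult_def)
qed

lemma iw_kernel_measurable [measurable]: "iw_kernel d D \<in> borel_measurable borel"
proof -
  \<comment> \<open>The kernel with the inverse spelled out by Cramer's rule and without the case
    distinction; it agrees with \<open>iw_kernel\<close> on positive definite matrices, where the
    determinant is nonzero.\<close>
  define f where "f X = det X powr (- (d + 2 * real CARD('a)) / 2) * exp (- (1/2) *
    (\<Sum>k\<in>UNIV. \<Sum>l\<in>UNIV. det (\<chi> i j. if j = k then (axis l 1 :: real^'a) $ i else X $ i $ j) / det X * D $ l $ k))"
    for X :: "real^'a^'a"
  have *: "(\<lambda>X::real^'a^'a. det (\<chi> i j. if j = k then (axis l 1 :: real^'a) $ i else X $ i $ j)) \<in> borel_measurable borel" for k l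
  proof (rule det_measurable)
    fix i j
    show "(\<lambda>X::real^'a^'a. (\<chi> i j. if j = k then (axis l 1 :: real^'a) $ i else X $ i $ j) $ i $ j) \<in> borel_measurable borel"
      by (cases "j = k") simp_all
  qed
  have [measurable]: "(\<lambda>X::real^'a^'a. det X) \<in> borel_measurable borel"
    by (rule det_measurable) simp
  have f: "f \<in> borel_measurable borel"
    unfolding f_def using * by measurable
  have "iw_kernel d D = (\<lambda>X. if X \<in> {X. posdef X} then f X else 0)"
    unfolding iw_kernel_def f_def
    by (rule ext) (auto simp: trace_matrix_inv_mult posdef_det_pos less_imp_neq[symmetric])
  also have "\<dots> \<in> borel_measurable borel"
    using f posdef_borel by (intro measurable_If_set) auto
  finally show ?thesis .
qed

lemma iw_density_measurable [measurable]: "iw_density d D \<in> borel_measurable borel"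
  unfolding iw_density_def[abs_def] by measurable

lemma sets_inverse_wishart [simp, measurable_cong]: "sets (inverse_wishart d D) = sets borel"
  and space_inverse_wishart [simp]: "space (inverse_wishart d D) = UNIV"
  by (simp_all add: inverse_wishart_def)

section \<open>Kernel and distribution under a congruence\<close>

text \<open>The trace is invariant and the determinant gains the factor
  \<open>(det A)\<^sup>2\<close>, so the kernel changes by a factor that does not depend on
  \<open>X\<close>.\<close>

lemma iw_kernel_congruence:
  fixes A X D :: "real^'m^'m"
  assumes "invertible A"
  shows "iw_kernel d D X = ((det A)\<^sup>2 powr ((d + 2 * real CARD('m)) / 2))
     * iw_kernel d (A ** D ** transpose A) (A ** X ** transpose A)"
proof (cases "posdef X")
  case True
  define e where "e = (d + 2 * real CARD('m)) / 2"
  have "det A \<noteq> 0" using assms by (simp add: invertible_det_nz)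
  have "invertible X"
    using posdef_det_pos[OF True] by (simp add: invertible_det_nz)
  then have tr: "trace (matrix_inv (A ** X ** transpose A) ** (A ** D ** transpose A)) = trace (matrix_inv X ** D)"
    by (rule trace_inv_congruence[OF assms])
  have "det (A ** X ** transpose A) powr (- e) = (det A)\<^sup>2 powr (- e) * det X powr (- e)"
    by (simp add: det_mul power2_eq_square powr_mult mult_ac)
  then have "(det A)\<^sup>2 powr e * det (A ** X ** transpose A) powr (- e) = det X powr (- e)"
    using \<open>det A \<noteq> 0\<close> by (simp add: mult.assoc[symmetric] flip: powr_add)
  moreover have "- (d + 2 * real CARD('m)) / 2 = - e" by (simp add: e_def minus_divide_left)
  ultimately show ?thesis
    unfolding iw_kernel_def tr posdef_congruence_iff[OF assms] using True
    by (simp only: e_def[symmetric] if_True mult.assoc[symmetric])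
qed (simp add: iw_kernel_def posdef_congruence_iff[OF assms])

lemma ennreal_mult_divide_mult_cancel_left:
  fixes a b k :: ennreal
  assumes "k \<noteq> 0" "k \<noteq> \<infinity>"
  shows "k * a / (k * b) = a / b"
proof -
  have "inverse (k * b) = inverse k * inverse b"
    using assms by (intro ennreal_inverse_mult') (auto simp: less_top zero_less_iff_neq_zero)
  moreover have "k * inverse k = 1"
    using assms by (metis divide_ennreal_def ennreal_divide_self infinity_ennreal_def less_top)
  ultimately show ?thesis
    by (simp add: divide_ennreal_def) (metis (no_types) mult.assoc mult.commute mult.left_neutral)
qed

text \<open>
  The constant Jacobian of \<open>X \<mapsto> A X A'\<close> and the constant factor of the kernel cancel against the
  same constants in the normalization, so neither has to be computed.
\<close>

lemma inverse_wishart_congruence: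
  fixes A D :: "real^'m^'m"
  assumes "invertible A"
  shows "distr (inverse_wishart d D) borel (\<lambda>X. A ** X ** transpose A)
    = inverse_wishart d (A ** D ** transpose A)"
proof -
  define T where "T = (\<lambda>X. A ** X ** transpose A)"
  define D' where "D' = A ** D ** transpose A"
  have [measurable]: "T \<in> borel_measurable borel"
    unfolding T_def by measurable
  obtain c where c: "0 < c" "c < \<infinity>" "distr sym_lborel borel T = density sym_lborel (\<lambda>_. c)"
    unfolding T_def by (rule distr_sym_lborel_congruence[OF assms])
  define \<kappa> where "\<kappa> = ennreal ((det A)\<^sup>2 powr ((d + 2 * real CARD('m)) / 2)) * c"
  have \<kappa>: "\<kappa> \<noteq> 0" "\<kappa> \<noteq> \<infinity>"
    using c(1,2) assms by (auto simp: \<kappa>_def invertible_det_nz ennreal_mult_eq_top_iff)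
  \<comment> \<open>Change of variables against a test function \<open>g\<close>: an indicator gives
    the numerators and the constant 1 the normalizing integrals, both with the same factor
    \<open>\<kappa>\<close>.\<close>
  have int: "(\<integral>\<^sup>+X. ennreal (iw_kernel d D X) * g (T X) \<partial>sym_lborel)
      = \<kappa> * (\<integral>\<^sup>+X. ennreal (iw_kernel d D' X) * g X \<partial>sym_lborel)"
    if [measurable]: "g \<in> borel_measurable borel" for g
  proof -
    let ?j = "ennreal ((det A)\<^sup>2 powr ((d + 2 * real CARD('m)) / 2))"
    have "ennreal (iw_kernel d D X) * g (T X) = ?j * (ennreal (iw_kernel d D' (T X)) * g (T X))" for X
      unfolding iw_kernel_congruence[OF assms, of d D X] T_def D'_def
      by (simp add: ennreal_mult' mult.assoc)
    then have "(\<integral>\<^sup>+X. ennreal (iw_kernel d D X) * g (T X) \<partial>sym_lborel)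
        = ?j * (\<integral>\<^sup>+X. ennreal (iw_kernel d D' (T X)) * g (T X) \<partial>sym_lborel)"
      by (simp add: nn_integral_cmult)
    also have "(\<integral>\<^sup>+X. ennreal (iw_kernel d D' (T X)) * g (T X) \<partial>sym_lborel)
        = (\<integral>\<^sup>+X. ennreal (iw_kernel d D' X) * g X \<partial>distr sym_lborel borel T)"
      by (subst nn_integral_distr) simp_all
    also have "\<dots> = c * (\<integral>\<^sup>+X. ennreal (iw_kernel d D' X) * g X \<partial>sym_lborel)"
      unfolding c(3) by (subst nn_integral_density) (simp_all add: nn_integral_cmult)
    finally show ?thesis by (simp add: \<kappa>_def mult.assoc)
  qed
  show ?thesis
    unfolding T_def[symmetric] D'_def[symmetric]
  proof (rule measure_eqI)
    fix E assume "E \<in> sets (distr (inverse_wishart d D) borel T)"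
    then have [measurable]: "E \<in> sets borel" by simp
    let ?Z = "\<lambda>D::real^'m^'m. \<integral>\<^sup>+X. ennreal (iw_kernel d D X) \<partial>sym_lborel"
    have em: "emeasure (inverse_wishart d D) B
        = (\<integral>\<^sup>+X. ennreal (iw_kernel d D X) * indicator B X \<partial>sym_lborel) / ?Z D"
      if [measurable]: "B \<in> sets borel" for B and D :: "real^'m^'m"
    proof -
      have "emeasure (inverse_wishart d D) B
          = (\<integral>\<^sup>+X. ennreal (iw_kernel d D X) * indicator B X / ?Z D \<partial>sym_lborel)"
        unfolding inverse_wishart_def
        by (subst emeasure_density) (auto simp: iw_density_def divide_ennreal_def mult_ac)
      then show ?thesis by (simp add: nn_integral_divide)
    qed
    have "emeasure (distr (inverse_wishart d D) borel T) E = emeasure (inverse_wishart d D) (T -` E)"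
      by (subst emeasure_distr) auto
    also have "\<dots> = (\<integral>\<^sup>+X. ennreal (iw_kernel d D X) * indicator E (T X) \<partial>sym_lborel) / ?Z D"
      using measurable_sets[of T borel borel E] by (subst em) (simp_all add: indicator_vimage)
    also have "\<dots> = (\<integral>\<^sup>+X. ennreal (iw_kernel d D' X) * indicator E X \<partial>sym_lborel) / ?Z D'"
      using int[of "indicator E"] int[of "\<lambda>_. 1"] by (simp add: ennreal_mult_divide_mult_cancel_left[OF \<kappa>])
    also have "\<dots> = emeasure (inverse_wishart d D') E"
      by (simp add: em)
    finally show "emeasure (distr (inverse_wishart d D) borel T) E = emeasure (inverse_wishart d D') E" .
  qed simp
qed

section \<open>Laws of the two diagonal blocks\<close>

lemma upper_block_measurable [measurable]: "upper_block \<in> borel_measurable borel"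
  and lower_block_measurable [measurable]: "lower_block \<in> borel_measurable borel"
  by (rule borel_measurable_matrixI; simp)+

text \<open>Elimination fixes the upper block and, with \<open>E\<close> normalizing the Schur
  complement to \<open>mat 1\<close>, leads to a scale matrix free of \<open>F\<close>. All valid
  \<open>F\<close> therefore give the same law of the upper block.\<close>

lemma distr_upper_block:
  fixes S F :: "real^'q^'q"
  assumes "n > 0" "posdef (iwar_scale n F S)" "transpose S = S"
  shows "distr (inverse_wishart d (iwar_scale n F S)) borel upper_block
    = distr (inverse_wishart d (n *\<^sub>R block_matrix S 0 0 (mat 1))) borel upper_block"
proof -
  have "posdef (S - F ** S ** transpose F)"
    using posdef_iwar_scale_iff assms by blast
  then obtain E :: "real^'q^'q" where E: "invertible E" "E ** (S - F ** S ** transpose F) ** transpose E = mat 1"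
    by (rule posdef_congruent_mat_1)
  define A where "A = block_matrix (mat 1) 0 (- (E ** F)) E"
  have A: "invertible A"
    unfolding A_def by (rule block_triangular_invertible[OF E(1)])
  have "distr (inverse_wishart d (n *\<^sub>R block_matrix S 0 0 (mat 1))) borel upper_block
      = distr (distr (inverse_wishart d (iwar_scale n F S)) borel (\<lambda>X. A ** X ** transpose A)) borel upper_block"
    unfolding inverse_wishart_congruence[OF A] unfolding A_def iwar_scale_eliminate[OF assms(3)] E(2) ..
  also have "\<dots> = distr (inverse_wishart d (iwar_scale n F S)) borel upper_block"
    by (subst distr_distr) (simp_all add: comp_def A_def upper_block_congruence)
  finally show ?thesis ..
qed

text \<open>After the exchange the lower block is the upper block for another coefficient
  \<open>G\<close>, and by \<open>distr_upper_block\<close> the coefficient does not influence the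
  law.\<close>

lemma distr_lower_block_eq_upper_block:
  fixes S F :: "real^'q^'q"
  assumes "n > 0" "posdef (iwar_scale n F S)" "transpose S = S"
  shows "distr (inverse_wishart d (iwar_scale n F S)) borel lower_block
    = distr (inverse_wishart d (iwar_scale n F S)) borel upper_block"
proof -
  have "posdef S"
    using posdef_iwar_scale_iff assms by blast
  then obtain G where G: "swap_matrix ** iwar_scale n F S ** transpose swap_matrix = iwar_scale n G S"
    by (rule swap_iwar_scale)
  have "posdef (iwar_scale n G S)"
    using posdef_congruence[OF swap_matrix_invertible assms(2)] by (simp only: G)
  have "distr (inverse_wishart d (iwar_scale n F S)) borel lower_block
      = distr (distr (inverse_wishart d (iwar_scale n F S)) borel
          (\<lambda>X. swap_matrix ** X ** transpose swap_matrix)) borel upper_block"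
    by (subst distr_distr) (simp_all add: comp_def upper_block_swap)
  also have "\<dots> = distr (inverse_wishart d (iwar_scale n G S)) borel upper_block"
    by (simp only: inverse_wishart_congruence[OF swap_matrix_invertible] G)
  also have "\<dots> = distr (inverse_wishart d (iwar_scale n F S)) borel upper_block"
    using assms \<open>posdef (iwar_scale n G S)\<close> by (simp only: distr_upper_block)
  finally show ?thesis .
qed

subsection \<open>Markov densities\<close>

lemma ennreal_divide_eq_1_iff:
  fixes a b :: ennreal
  assumes "b \<noteq> 0" "b \<noteq> \<infinity>"
  shows "a / b = 1 \<longleftrightarrow> a = b"
proof
  assume "a / b = 1"
  then have "a / b * b = b" by simp
  moreover have "a / b * b = a * b / b" by (simp add: divide_ennreal_def mult_ac)
  ultimately show "a = b"
    using assms by (simp add: mult_divide_eq_ennreal)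
qed (use assms in \<open>simp add: ennreal_divide_self less_top\<close>)

text \<open>The exceptional set lies in a box with one null factor, and zero times infinity is zero
  in \<open>ennreal\<close>.\<close>

lemma AE_PiM_coordinate:
  assumes "sigma_finite_measure L" "finite I" "i \<in> I" "AE x in L. P x"
  shows "AE x in Pi\<^sub>M I (\<lambda>_. L). P (x i)"
proof -
  interpret L: sigma_finite_measure L by fact
  interpret product_sigma_finite "\<lambda>_. L" ..
  obtain N where N: "{x \<in> space L. \<not> P x} \<subseteq> N" "emeasure L N = 0" "N \<in> sets L"
    by (rule AE_E[OF assms(4)])
  define A where "A j = (if j = i then N else space L)" for j
  have A: "A j \<in> sets L" for j
    using N(3) by (simp add: A_def)
  show ?thesis
  proof (rule AE_I)
    show "{x \<in> space (Pi\<^sub>M I (\<lambda>_. L)). \<not> P (x i)} \<subseteq> Pi\<^sub>E I A"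
      using N(1) assms(3) by (auto simp: space_PiM A_def PiE_def Pi_def)
    show "Pi\<^sub>E I A \<in> sets (Pi\<^sub>M I (\<lambda>_. L))"
      using A assms(2) by (intro sets_PiM_I_finite) auto
    have "emeasure L (A i) = 0" by (simp add: A_def N)
    then have "\<exists>j\<in>I. emeasure L (A j) = 0" using assms(3) by blast
    then show "emeasure (Pi\<^sub>M I (\<lambda>_. L)) (Pi\<^sub>E I A) = 0"
      by (subst emeasure_PiM) (use assms(2) A in \<open>auto simp: prod_zero\<close>)
  qed
qed

section \<open>Splitting off the first coordinate of a path\<close>

text \<open>\<open>case_nat a x\<close> prepends the state \<open>a\<close> to the path
  \<open>x\<close> and moves every other index up by one; it stays undefined beyond
  \<open>Suc K\<close>, as the product space demands.\<close>

lemma measurable_case_nat_PiM: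
  "(\<lambda>(a, x). case_nat a x) \<in> L \<Otimes>\<^sub>M Pi\<^sub>M {0..K} (\<lambda>_. L) \<rightarrow>\<^sub>M Pi\<^sub>M {0..Suc K} (\<lambda>_. L)"
proof (rule measurable_PiM_single')
  fix i assume i: "i \<in> {0..Suc K}"
  show "(\<lambda>w. (case w of (a, x) \<Rightarrow> case_nat a x) i) \<in> L \<Otimes>\<^sub>M Pi\<^sub>M {0..K} (\<lambda>_. L) \<rightarrow>\<^sub>M L"
  proof (cases i)
    case (Suc j)
    with i have "(\<lambda>w. snd w j) \<in> L \<Otimes>\<^sub>M Pi\<^sub>M {0..K} (\<lambda>_. L) \<rightarrow>\<^sub>M L"
      by (intro measurable_compose[OF measurable_snd measurable_component_singleton]) auto
    with Suc show ?thesis by (simp add: case_prod_beta)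
  qed (simp add: case_prod_beta)
qed (auto simp: space_pair_measure space_PiM PiE_def Pi_def extensional_def split: nat.split)

lemma distr_case_nat_PiM:
  assumes "sigma_finite_measure L"
  shows "distr (L \<Otimes>\<^sub>M Pi\<^sub>M {0..K} (\<lambda>_. L)) (Pi\<^sub>M {0..Suc K} (\<lambda>_. L)) (\<lambda>(a, x). case_nat a x)
    = Pi\<^sub>M {0..Suc K} (\<lambda>_. L)"
proof -
  interpret L: sigma_finite_measure L by fact
  interpret product_sigma_finite "\<lambda>_. L" ..
  interpret R: sigma_finite_measure "Pi\<^sub>M {0..K} (\<lambda>_. L)"
    by (rule sigma_finite) simp
  interpret pair_sigma_finite L "Pi\<^sub>M {0..K} (\<lambda>_. L)" ..
  show ?thesis
  proof (rule PiM_eqI)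
    fix A :: "nat \<Rightarrow> 'a set" assume A: "\<And>i. i \<in> {0..Suc K} \<Longrightarrow> A i \<in> sets L"
    have 1: "Pi\<^sub>E {0..Suc K} A \<in> sets (Pi\<^sub>M {0..Suc K} (\<lambda>_. L))"
      using A by (intro sets_PiM_I_finite) auto
    have 2: "Pi\<^sub>E {0..K} (\<lambda>i. A (Suc i)) \<in> sets (Pi\<^sub>M {0..K} (\<lambda>_. L))"
      using A by (intro sets_PiM_I_finite) auto
    have "(\<lambda>(a, x). case_nat a x) -` Pi\<^sub>E {0..Suc K} A \<inter> space (L \<Otimes>\<^sub>M Pi\<^sub>M {0..K} (\<lambda>_. L))
        = A 0 \<times> Pi\<^sub>E {0..K} (\<lambda>i. A (Suc i))"
    proof -
      have *: "case_nat a x \<in> Pi\<^sub>E {0..Suc K} A \<longleftrightarrow> a \<in> A 0 \<and> (\<forall>i\<le>K. x i \<in> A (Suc i))"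
        if "x \<in> extensional {0..K}" for a x
      proof -
        have "case_nat a x \<in> extensional {0..Suc K}"
          using that by (simp add: extensional_def split: nat.split)
        moreover have "(\<forall>i\<in>{0..Suc K}. Q i) \<longleftrightarrow> Q 0 \<and> (\<forall>i\<le>K. Q (Suc i))" for Q
          by (metis Suc_le_mono atLeast0AtMost atMost_iff nat.exhaust zero_le)
        ultimately show ?thesis
          by (simp only: PiE_iff) simp
      qed
      have L0: "a \<in> space L" if "a \<in> A 0" for a
        using that sets.sets_into_space[OF A[of 0]] by auto
      have L1: "b \<in> space L" if "b \<in> A (Suc i)" "i \<le> K" for b i
        using that sets.sets_into_space[OF A[of "Suc i"]] by auto
      show ?thesis
        by (auto simp: space_pair_measure space_PiM * PiE_iff[of _ "{0..K}"] intro: L0 L1)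
    qed
    then have "emeasure (distr (L \<Otimes>\<^sub>M Pi\<^sub>M {0..K} (\<lambda>_. L)) (Pi\<^sub>M {0..Suc K} (\<lambda>_. L)) (\<lambda>(a, x). case_nat a x)) (Pi\<^sub>E {0..Suc K} A)
        = emeasure L (A 0) * (\<Prod>i=0..K. emeasure L (A (Suc i)))"
      using A emeasure_PiM[of "{0..K}" "\<lambda>i. A (Suc i)"]
      by (simp add: emeasure_distr[OF measurable_case_nat_PiM 1] R.emeasure_pair_measure_Times[OF _ 2])
    also have "\<dots> = (\<Prod>i=0..Suc K. emeasure L (A i))"
      by (simp only: prod.atLeast0_atMost_Suc_shift comp_def)
    finally show "emeasure (distr (L \<Otimes>\<^sub>M Pi\<^sub>M {0..K} (\<lambda>_. L)) (Pi\<^sub>M {0..Suc K} (\<lambda>_. L)) (\<lambda>(a, x). case_nat a x)) (Pi\<^sub>E {0..Suc K} A)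
        = (\<Prod>i=0..Suc K. emeasure L (A i))" .
  qed simp_all
qed

text \<open>Fubini in both orders. The second, with the prepended state innermost, is the one that
  integrates out the initial state.\<close>

lemma nn_integral_PiM_case_nat:
  assumes "sigma_finite_measure L" and F: "F \<in> borel_measurable (Pi\<^sub>M {0..Suc K} (\<lambda>_. L))"
  shows "(\<integral>\<^sup>+x. F x \<partial>Pi\<^sub>M {0..Suc K} (\<lambda>_. L)) = (\<integral>\<^sup>+a. \<integral>\<^sup>+x. F (case_nat a x) \<partial>Pi\<^sub>M {0..K} (\<lambda>_. L) \<partial>L)"
    and "(\<integral>\<^sup>+x. F x \<partial>Pi\<^sub>M {0..Suc K} (\<lambda>_. L)) = (\<integral>\<^sup>+x. \<integral>\<^sup>+a. F (case_nat a x) \<partial>L \<partial>Pi\<^sub>M {0..K} (\<lambda>_. L))"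
proof -
  interpret L: sigma_finite_measure L by fact
  interpret product_sigma_finite "\<lambda>_. L" ..
  interpret R: sigma_finite_measure "Pi\<^sub>M {0..K} (\<lambda>_. L)"
    by (rule sigma_finite) simp
  interpret pair_sigma_finite L "Pi\<^sub>M {0..K} (\<lambda>_. L)" ..
  have F': "(\<lambda>w. F (case_nat (fst w) (snd w))) \<in> borel_measurable (L \<Otimes>\<^sub>M Pi\<^sub>M {0..K} (\<lambda>_. L))"
    using measurable_compose[OF measurable_case_nat_PiM F] by (simp add: case_prod_beta)
  have *: "(\<integral>\<^sup>+x. F x \<partial>Pi\<^sub>M {0..Suc K} (\<lambda>_. L)) = (\<integral>\<^sup>+w. F (case_nat (fst w) (snd w)) \<partial>(L \<Otimes>\<^sub>M Pi\<^sub>M {0..K} (\<lambda>_. L)))"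
    by (subst distr_case_nat_PiM[OF assms(1), symmetric])
       (subst nn_integral_distr[OF measurable_case_nat_PiM], use F in \<open>simp_all add: case_prod_beta\<close>)
  show "(\<integral>\<^sup>+x. F x \<partial>Pi\<^sub>M {0..Suc K} (\<lambda>_. L)) = (\<integral>\<^sup>+a. \<integral>\<^sup>+x. F (case_nat a x) \<partial>Pi\<^sub>M {0..K} (\<lambda>_. L) \<partial>L)"
    unfolding * using R.nn_integral_fst[OF F'] by simp
  show "(\<integral>\<^sup>+x. F x \<partial>Pi\<^sub>M {0..Suc K} (\<lambda>_. L)) = (\<integral>\<^sup>+x. \<integral>\<^sup>+a. F (case_nat a x) \<partial>L \<partial>Pi\<^sub>M {0..K} (\<lambda>_. L))"
    unfolding * using nn_integral_snd[OF F'] by simp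
qed

lemma nn_integral_PiM_two:
  assumes "sigma_finite_measure L" and F: "(\<lambda>w. F (fst w) (snd w)) \<in> borel_measurable (L \<Otimes>\<^sub>M L)"
  shows "(\<integral>\<^sup>+x. F (x 0) (x (Suc 0)) \<partial>Pi\<^sub>M {0..Suc 0} (\<lambda>_. L)) = (\<integral>\<^sup>+a. \<integral>\<^sup>+b. F a b \<partial>L \<partial>L)"
proof -
  interpret L: sigma_finite_measure L by fact
  interpret product_sigma_finite "\<lambda>_. L" ..
  have "(\<lambda>x. (x 0, x (Suc 0))) \<in> Pi\<^sub>M {0..Suc 0} (\<lambda>_. L) \<rightarrow>\<^sub>M L \<Otimes>\<^sub>M L"
    by (intro measurable_Pair measurable_component_singleton) auto
  from measurable_compose[OF this F]
  have "(\<integral>\<^sup>+x. F (x 0) (x (Suc 0)) \<partial>Pi\<^sub>M {0..Suc 0} (\<lambda>_. L))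
      = (\<integral>\<^sup>+a. \<integral>\<^sup>+x. F a (x 0) \<partial>Pi\<^sub>M {0::nat} (\<lambda>_. L) \<partial>L)"
    by (subst nn_integral_PiM_case_nat(1)[OF assms(1)]) simp_all
  also have "\<dots> = (\<integral>\<^sup>+a. \<integral>\<^sup>+b. F a b \<partial>L \<partial>L)"
  proof (rule nn_integral_cong)
    fix a assume "a \<in> space L"
    then have "F a \<in> borel_measurable L"
      using measurable_compose_Pair1[OF _ F, of a] by simp
    then show "(\<integral>\<^sup>+x. F a (x 0) \<partial>Pi\<^sub>M {0::nat} (\<lambda>_. L)) = (\<integral>\<^sup>+b. F a b \<partial>L)"
      by (rule product_nn_integral_singleton)
  qed
  finally show ?thesis .
qed

section \<open>Shift invariance of a chain with Markov path densities\<close>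

text \<open>The path density of \<open>iwar_process\<close>, with the pair density and the
  denominator left abstract.\<close>

definition markov_density :: "('b \<times> 'b \<Rightarrow> ennreal) \<Rightarrow> ('b \<Rightarrow> ennreal) \<Rightarrow> nat \<Rightarrow> (nat \<Rightarrow> 'b) \<Rightarrow> ennreal" where
  "markov_density p g T x = (\<Prod>t=1..T. p (x (t - 1), x t)) / (\<Prod>t=2..T. g (x (t - 1)))"

text \<open>For \<open>K \<ge> 1\<close> the old initial state \<open>x 0\<close> becomes interior
  and contributes the factor \<open>g (x 0)\<close>. The denominator stays one product because
  \<open>ennreal\<close> inversion need not split when one factor is 0 and another infinite.\<close>

lemma markov_density_case_nat:
  assumes "K \<ge> 1"
  shows "markov_density p g (Suc K) (case_nat a x) = p (a, x 0) *
    ((\<Prod>t=1..K. p (x (t - 1), x t)) / (g (x 0) * (\<Prod>t=2..K. g (x (t - 1)))))"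
proof -
  have "(\<Prod>t=1..Suc K. p (case_nat a x (t - 1), case_nat a x t)) = (\<Prod>t=0..K. p (case_nat a x t, x t))"
    unfolding One_nat_def prod.atLeast_Suc_atMost_Suc_shift by simp
  also have "\<dots> = p (a, x 0) * (\<Prod>t=1..K. p (case_nat a x t, x t))"
    by (simp add: prod.atLeast_Suc_atMost)
  also have "(\<Prod>t=1..K. p (case_nat a x t, x t)) = (\<Prod>t=1..K. p (x (t - 1), x t))"
    by (rule prod.cong) (auto split: nat.split)
  finally have 1: "(\<Prod>t=1..Suc K. p (case_nat a x (t - 1), case_nat a x t))
    = p (a, x 0) * (\<Prod>t=1..K. p (x (t - 1), x t))" .
  have "(\<Prod>t=2..Suc K. g (case_nat a x (t - 1))) = (\<Prod>t=1..K. g (case_nat a x t))"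
    using prod.atLeast_Suc_atMost_Suc_shift[of "\<lambda>t. g (case_nat a x (t - 1))" 1 K]
    by (simp only: numeral_2_eq_2 One_nat_def comp_def diff_Suc_Suc diff_zero)
  also have "\<dots> = (\<Prod>t=1..K. g (x (t - 1)))"
    by (rule prod.cong) (auto split: nat.split)
  also have "\<dots> = g (x 0) * (\<Prod>t=2..K. g (x (t - 1)))"
    using assms by (simp add: prod.atLeast_Suc_atMost numeral_2_eq_2)
  finally have 2: "(\<Prod>t=2..Suc K. g (case_nat a x (t - 1))) = g (x 0) * (\<Prod>t=2..K. g (x (t - 1)))" .
  show ?thesis
    unfolding markov_density_def 1 2 by (simp add: ennreal_times_divide)
qed


text \<open>Integrating the first state out of the density for \<open>Suc K\<close> replaces
  \<open>p (a, x 0)\<close> by the second marginal at \<open>x 0\<close>. Where the path density for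
  \<open>K\<close> is positive this marginal almost everywhere equals \<open>g (x 0)\<close>, and
  the two cancel.\<close>

lemma markov_density_shift:
  fixes X :: "nat \<Rightarrow> 'w \<Rightarrow> 'b"
  assumes "prob_space M" and L: "sigma_finite_measure L"
    and p: "p \<in> borel_measurable (L \<Otimes>\<^sub>M L)" and g: "g \<in> borel_measurable L"
    and marginals: "AE x in L. (\<integral>\<^sup>+y. p (x, y) \<partial>L) = (\<integral>\<^sup>+y. p (y, x) \<partial>L)"
    and X: "\<And>T. T \<ge> 1 \<Longrightarrow> distributed M (Pi\<^sub>M {0..T} (\<lambda>_. L)) (\<lambda>\<omega>. \<lambda>t\<in>{0..T}. X t \<omega>) (markov_density p g T)"
    and "K \<ge> 1"
  shows "distr M (Pi\<^sub>M {0..K} (\<lambda>_. L)) (\<lambda>\<omega>. \<lambda>i\<in>{0..K}. X (Suc i) \<omega>)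
    = distr M (Pi\<^sub>M {0..K} (\<lambda>_. L)) (\<lambda>\<omega>. \<lambda>i\<in>{0..K}. X i \<omega>)"
proof -
  interpret prob_space M by fact
  interpret L: sigma_finite_measure L by fact
  interpret product_sigma_finite "\<lambda>_. L" ..
  interpret LL: pair_sigma_finite L L ..
  note [measurable] = p g
  have X_measurable [measurable]: "X t \<in> M \<rightarrow>\<^sub>M L" for t
  proof -
    have "(\<lambda>\<omega>. \<lambda>i\<in>{0..Suc t}. X i \<omega>) \<in> M \<rightarrow>\<^sub>M Pi\<^sub>M {0..Suc t} (\<lambda>_. L)"
      by (rule distributed_measurable[OF X]) simp
    from measurable_compose[OF this measurable_component_singleton, of t] show ?thesis by simp
  qed
  have law: "(\<integral>\<^sup>+\<omega>. \<phi> (\<lambda>t\<in>{0..T}. X t \<omega>) \<partial>M) = (\<integral>\<^sup>+x. markov_density p g T x * \<phi> x \<partial>Pi\<^sub>M {0..T} (\<lambda>_. L))"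
    if "T \<ge> 1" "\<phi> \<in> borel_measurable (Pi\<^sub>M {0..T} (\<lambda>_. L))" for T \<phi>
    by (rule distributed_nn_integral[OF X, symmetric]) (use that in auto)
  have markov_measurable: "markov_density p g T \<in> borel_measurable (Pi\<^sub>M {0..T} (\<lambda>_. L))" if "T \<ge> 1" for T
    using distributed_borel_measurable[OF X[OF that]] .

  define h where "h x = (\<integral>\<^sup>+y. p (x, y) \<partial>L)" for x
  define h' where "h' y = (\<integral>\<^sup>+x. p (x, y) \<partial>L)" for y
  have [measurable]: "h \<in> borel_measurable L" "h' \<in> borel_measurable L"
    unfolding h_def[abs_def] h'_def[abs_def] by measurable
  have h_eq: "AE x in L. h x = h' x"
    using marginals by (simp add: h_def h'_def)

  \<comment> \<open>For \<open>T = 1\<close> the denominator is an empty product, so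
    \<open>p\<close> itself is the density of the first two states.\<close>
  have pair: "distributed M (L \<Otimes>\<^sub>M L) (\<lambda>\<omega>. (X 0 \<omega>, X 1 \<omega>)) p"
    unfolding distributed_def
  proof (intro conjI p)
    show "distr M (L \<Otimes>\<^sub>M L) (\<lambda>\<omega>. (X 0 \<omega>, X 1 \<omega>)) = density (L \<Otimes>\<^sub>M L) p"
    proof (rule measure_eqI)
      fix E assume "E \<in> sets (distr M (L \<Otimes>\<^sub>M L) (\<lambda>\<omega>. (X 0 \<omega>, X 1 \<omega>)))"
      then have E[measurable]: "E \<in> sets (L \<Otimes>\<^sub>M L)" by simp
      have [measurable]: "(\<lambda>x. (x 0, x (Suc 0))) \<in> Pi\<^sub>M {0..1::nat} (\<lambda>_. L) \<rightarrow>\<^sub>M L \<Otimes>\<^sub>M L"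
        by (intro measurable_Pair measurable_component_singleton) auto
      have "emeasure (distr M (L \<Otimes>\<^sub>M L) (\<lambda>\<omega>. (X 0 \<omega>, X 1 \<omega>))) E = (\<integral>\<^sup>+\<omega>. indicator E (X 0 \<omega>, X (Suc 0) \<omega>) \<partial>M)"
        by (subst nn_integral_indicator[symmetric], simp, subst nn_integral_distr) simp_all
      also have "\<dots> = (\<integral>\<^sup>+x. markov_density p g 1 x * indicator E (x 0, x (Suc 0)) \<partial>Pi\<^sub>M {0..1} (\<lambda>_. L))"
        by (subst law[symmetric]) simp_all
      also have "\<dots> = (\<integral>\<^sup>+x. p (x 0, x (Suc 0)) * indicator E (x 0, x (Suc 0)) \<partial>Pi\<^sub>M {0..Suc 0} (\<lambda>_. L))"
        by (simp add: markov_density_def divide_ennreal_def)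
      also have "\<dots> = (\<integral>\<^sup>+a. \<integral>\<^sup>+b. p (a, b) * indicator E (a, b) \<partial>L \<partial>L)"
        by (rule nn_integral_PiM_two[OF L]) simp
      also have "\<dots> = emeasure (density (L \<Otimes>\<^sub>M L) p) E"
        by (subst L.nn_integral_fst) (simp_all add: emeasure_density)
      finally show "emeasure (distr M (L \<Otimes>\<^sub>M L) (\<lambda>\<omega>. (X 0 \<omega>, X 1 \<omega>))) E = emeasure (density (L \<Otimes>\<^sub>M L) p) E" .
    qed simp
  qed simp
  have X0: "distributed M L (X 0) h"
    using distr_marginal1[OF L L pair] by (simp add: h_def[abs_def])
  have X1: "distributed M L (X 1) h'"
    using distr_marginal2[OF L L pair] by (simp add: h'_def[abs_def])

  \<comment> \<open>Two densities of \<open>X 1\<close>: one from \<open>T = 1\<close>, the other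
    from \<open>T = 2\<close> by integrating out both neighbours.\<close>
  have "AE x in L. h' x = h' x * (h x / g x)"
  proof (rule L.density_unique)
    show "density L h' = density L (\<lambda>x. h' x * (h x / g x))"
    proof (rule measure_eqI)
      fix E assume "E \<in> sets (density L h')"
      then have E[measurable]: "E \<in> sets L" by simp
      have coord: "(\<lambda>x. x (Suc 0)) \<in> Pi\<^sub>M {0..2} (\<lambda>_. L) \<rightarrow>\<^sub>M L"
        by (rule measurable_component_singleton) simp
      have ind: "(\<lambda>x. indicator E (x (Suc 0)) :: ennreal) \<in> borel_measurable (Pi\<^sub>M {0..Suc 1} (\<lambda>_. L))"
        using measurable_compose[OF coord, of "indicator E"] by (simp add: numeral_2_eq_2)
      have "emeasure (density L h') E = (\<integral>\<^sup>+\<omega>. indicator E (X 1 \<omega>) \<partial>M)"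
        by (subst distributed_nn_integral[OF X1, symmetric]) (simp_all add: emeasure_density)
      also have "\<dots> = (\<integral>\<^sup>+x. markov_density p g (Suc 1) x * indicator E (x (Suc 0)) \<partial>Pi\<^sub>M {0..Suc 1} (\<lambda>_. L))"
        by (subst law[symmetric, OF _ ind]) simp_all
      \<comment> \<open>The state at time 1 of \<open>case_nat a x\<close> is \<open>x 0\<close>,
        which explains the shifted argument of the indicator.\<close>
      also have "\<dots> = (\<integral>\<^sup>+x. \<integral>\<^sup>+a. markov_density p g (Suc 1) (case_nat a x) * indicator E (x 0) \<partial>L \<partial>Pi\<^sub>M {0..1} (\<lambda>_. L))"
        using markov_measurable[of "Suc 1"] ind
        by (subst nn_integral_PiM_case_nat(2)[OF L]) (auto intro: borel_measurable_times)
      also have "\<dots> = (\<integral>\<^sup>+x. \<integral>\<^sup>+a. p (a, x 0) * (p (x 0, x (Suc 0)) / g (x 0) * indicator E (x 0)) \<partial>L \<partial>Pi\<^sub>M {0..1} (\<lambda>_. L))"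
        by (subst markov_density_case_nat) (simp_all add: mult.assoc)
      also have "\<dots> = (\<integral>\<^sup>+x. h' (x 0) * (p (x 0, x (Suc 0)) / g (x 0) * indicator E (x 0)) \<partial>Pi\<^sub>M {0..Suc 0} (\<lambda>_. L))"
        unfolding One_nat_def
      proof (rule nn_integral_cong)
        fix x assume "x \<in> space (Pi\<^sub>M {0..Suc 0} (\<lambda>_. L))"
        then have [measurable]: "x 0 \<in> space L" by (auto simp: space_PiM)
        show "(\<integral>\<^sup>+a. p (a, x 0) * (p (x 0, x (Suc 0)) / g (x 0) * indicator E (x 0)) \<partial>L)
            = h' (x 0) * (p (x 0, x (Suc 0)) / g (x 0) * indicator E (x 0))"
          unfolding h'_def by (rule nn_integral_multc) measurable
      qed
      also have "\<dots> = (\<integral>\<^sup>+a. \<integral>\<^sup>+b. h' a * (p (a, b) / g a * indicator E a) \<partial>L \<partial>L)"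
        by (rule nn_integral_PiM_two[OF L]) simp
      also have "\<dots> = (\<integral>\<^sup>+a. h' a * (h a / g a) * indicator E a \<partial>L)"
      proof (rule nn_integral_cong)
        fix a assume [measurable]: "a \<in> space L"
        have "(\<integral>\<^sup>+b. h' a * (p (a, b) / g a * indicator E a) \<partial>L) = (\<integral>\<^sup>+b. p (a, b) * (h' a / g a * indicator E a) \<partial>L)"
          by (rule nn_integral_cong) (simp add: divide_ennreal_def mult_ac)
        also have "\<dots> = h a * (h' a / g a * indicator E a)"
          unfolding h_def by (rule nn_integral_multc) measurable
        finally show "(\<integral>\<^sup>+b. h' a * (p (a, b) / g a * indicator E a) \<partial>L) = h' a * (h a / g a) * indicator E a"
          by (simp add: divide_ennreal_def mult_ac)
      qed
      also have "\<dots> = emeasure (density L (\<lambda>x. h' x * (h x / g x))) E"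
        by (simp add: emeasure_density)
      finally show "emeasure (density L h') E = emeasure (density L (\<lambda>x. h' x * (h x / g x))) E" .
    qed simp
  qed simp_all
  \<comment> \<open>Finiteness is what permits cancelling the marginal from both sides
    below.\<close>
  moreover have "AE x in L. h' x \<noteq> \<infinity>"
  proof (rule nn_integral_PInf_AE)
    have "(\<integral>\<^sup>+x. h' x \<partial>L) = 1"
      using distributed_nn_integral[OF X1, of "\<lambda>_. 1"] by (simp add: emeasure_space_1)
    then show "(\<integral>\<^sup>+x. h' x \<partial>L) \<noteq> \<infinity>" by simp
  qed simp
  ultimately have g_eq: "AE x in L. h x = h' x \<and> (h x = 0 \<or> h x = g x \<and> g x \<noteq> 0 \<and> g x \<noteq> \<infinity>)"
    using h_eq
  proof eventually_elim
    case (elim x)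
    show ?case
    proof (cases "h x = 0")
      case False
      have "h x * 1 = h x * (h x / g x)" using elim by simp
      then have "h x / g x = 1"
        using False elim by (metis ennreal_mult_cancel_left infinity_ennreal_def)
      \<comment> \<open>For nonzero \<open>h x\<close>, a zero \<open>g x\<close> would make the
        quotient infinite; an infinite \<open>g x\<close> would make it zero.\<close>
      moreover from this have "g x \<noteq> 0"
        using False by (auto simp: ennreal_divide_zero)
      moreover have "g x \<noteq> \<infinity>"
        using \<open>h x / g x = 1\<close> by auto
      ultimately have "h x = g x"
        using \<open>h x / g x = 1\<close> by (simp add: ennreal_divide_eq_1_iff)
      then show ?thesis
        using elim \<open>g x \<noteq> 0\<close> \<open>g x \<noteq> \<infinity>\<close> by simp
    qed (use elim in simp)
  qed

  let ?P = "Pi\<^sub>M {0..K} (\<lambda>_. L)"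
  have coord0: "(\<lambda>x. x 0) \<in> ?P \<rightarrow>\<^sub>M L"
    by (rule measurable_component_singleton) simp
  \<comment> \<open>Since \<open>h\<close> is the density of \<open>X 0\<close>, it is almost surely
    nonzero there; \<open>distributed_AE2\<close> turns this into a statement about the path
    density.\<close>
  have null: "AE x in ?P. 0 < markov_density p g K x \<longrightarrow> h (x 0) \<noteq> 0"
  proof (rule distributed_AE2[OF X[OF \<open>K \<ge> 1\<close>], THEN iffD1])
    have "Measurable.pred L (\<lambda>x. h x \<noteq> 0)" by measurable
    then show "Measurable.pred ?P (\<lambda>x. h (x 0) \<noteq> 0)"
      by (rule measurable_compose[OF coord0])
    have "AE \<omega> in M. h (X 0 \<omega>) \<noteq> 0"
      by (rule distributed_AE2[OF X0, THEN iffD2]) auto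
    then show "AE \<omega> in M. h ((\<lambda>t\<in>{0..K}. X t \<omega>) 0) \<noteq> 0" by simp
  qed
  have g_eq0: "AE x in ?P. h (x 0) = h' (x 0) \<and>
      (h (x 0) = 0 \<or> h (x 0) = g (x 0) \<and> g (x 0) \<noteq> 0 \<and> g (x 0) \<noteq> \<infinity>)"
    by (rule AE_PiM_coordinate[OF L _ _ g_eq]) auto
  \<comment> \<open>The exceptional set may depend on the fixed constant \<open>c\<close>. Taking
    \<open>c\<close> as 0 and as 1 covers both values of an indicator.\<close>
  have AE_shift: "AE x in ?P. (\<integral>\<^sup>+a. markov_density p g (Suc K) (case_nat a x) * c \<partial>L)
      = markov_density p g K x * c" for c
    using null g_eq0 AE_space[of ?P]
  proof eventually_elim
    case (elim x)
    then have [measurable]: "x 0 \<in> space L" by (auto simp: space_PiM)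
    define A B where "A = (\<Prod>t=1..K. p (x (t - 1), x t))" and "B = (\<Prod>t=2..K. g (x (t - 1)))"
    have "(\<integral>\<^sup>+a. markov_density p g (Suc K) (case_nat a x) * c \<partial>L)
        = (\<integral>\<^sup>+a. p (a, x 0) * (A / (g (x 0) * B) * c) \<partial>L)"
      unfolding A_def B_def markov_density_case_nat[OF \<open>K \<ge> 1\<close>] by (simp add: mult.assoc)
    also have "\<dots> = h' (x 0) * (A / (g (x 0) * B) * c)"
      unfolding h'_def by (rule nn_integral_multc) measurable
    also have "\<dots> = A / B * c"
    proof (cases "h (x 0) = 0")
      \<comment> \<open>Both sides vanish: the left because \<open>h' (x 0) = h (x 0) = 0\<close>,
        the right because \<open>null\<close> rules out a positive path density.\<close>
      case True
      with elim show ?thesis by (simp add: A_def B_def markov_density_def)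
    next
      case False
      with elim have "h' (x 0) = g (x 0)" "g (x 0) \<noteq> 0" "g (x 0) \<noteq> \<infinity>" by auto
      then show ?thesis
        using ennreal_mult_divide_mult_cancel_left[of "g (x 0)" A B]
        by (simp add: ennreal_times_divide flip: mult.assoc)
    qed
    finally show ?case by (simp add: A_def B_def markov_density_def)
  qed

  show ?thesis
  proof (rule measure_eqI)
    fix E assume "E \<in> sets (distr M ?P (\<lambda>\<omega>. \<lambda>i\<in>{0..K}. X (Suc i) \<omega>))"
    then have E[measurable]: "E \<in> sets ?P" by simp
    have shift: "(\<lambda>x. \<lambda>i\<in>{0..K}. x (Suc i)) \<in> Pi\<^sub>M {0..Suc K} (\<lambda>_. L) \<rightarrow>\<^sub>M ?P"
      by (intro measurable_restrict measurable_component_singleton) auto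
    have ind: "(\<lambda>x. indicator E (\<lambda>i\<in>{0..K}. x (Suc i)) :: ennreal) \<in> borel_measurable (Pi\<^sub>M {0..Suc K} (\<lambda>_. L))"
      using measurable_compose[OF shift, of "indicator E"] by simp
    have em: "emeasure (distr M ?P (\<lambda>\<omega>. \<lambda>i\<in>{0..K}. Y i \<omega>)) E = (\<integral>\<^sup>+\<omega>. indicator E (\<lambda>i\<in>{0..K}. Y i \<omega>) \<partial>M)"
      if "\<And>i. Y i \<in> M \<rightarrow>\<^sub>M L" for Y
    proof -
      have "(\<lambda>\<omega>. \<lambda>i\<in>{0..K}. Y i \<omega>) \<in> M \<rightarrow>\<^sub>M ?P"
        by (rule measurable_restrict) (rule that)
      then show ?thesis
        by (subst nn_integral_indicator[symmetric], simp, subst nn_integral_distr) simp_all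
    qed
    have "emeasure (distr M ?P (\<lambda>\<omega>. \<lambda>i\<in>{0..K}. X (Suc i) \<omega>)) E
        = (\<integral>\<^sup>+\<omega>. indicator E (\<lambda>i\<in>{0..K}. (\<lambda>t\<in>{0..Suc K}. X t \<omega>) (Suc i)) \<partial>M)"
      by (subst em) (simp_all cong: restrict_cong)
    also have "\<dots> = (\<integral>\<^sup>+x. markov_density p g (Suc K) x * indicator E (\<lambda>i\<in>{0..K}. x (Suc i)) \<partial>Pi\<^sub>M {0..Suc K} (\<lambda>_. L))"
      by (rule law[OF _ ind]) simp
    also have "\<dots> = (\<integral>\<^sup>+x. \<integral>\<^sup>+a. markov_density p g (Suc K) (case_nat a x) * indicator E (restrict x {0..K}) \<partial>L \<partial>?P)"
      using markov_measurable[of "Suc K"] ind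
      by (subst nn_integral_PiM_case_nat(2)[OF L]) (auto intro: borel_measurable_times)
    also have "\<dots> = (\<integral>\<^sup>+x. \<integral>\<^sup>+a. markov_density p g (Suc K) (case_nat a x) * indicator E x \<partial>L \<partial>?P)"
      by (rule nn_integral_cong) (simp add: space_PiM PiE_restrict)
    also have "\<dots> = (\<integral>\<^sup>+x. markov_density p g K x * indicator E x \<partial>?P)"
    proof (rule nn_integral_cong_AE)
      show "AE x in ?P. (\<integral>\<^sup>+a. markov_density p g (Suc K) (case_nat a x) * indicator E x \<partial>L)
          = markov_density p g K x * indicator E x"
        using AE_shift[of 1] AE_shift[of 0] by eventually_elim (auto simp: indicator_def)
    qed
    also have "\<dots> = emeasure (distr M ?P (\<lambda>\<omega>. \<lambda>i\<in>{0..K}. X i \<omega>)) E"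
      by (subst law[OF \<open>K \<ge> 1\<close>, symmetric]) (simp_all add: em)
    finally show "emeasure (distr M ?P (\<lambda>\<omega>. \<lambda>i\<in>{0..K}. X (Suc i) \<omega>)) E
        = emeasure (distr M ?P (\<lambda>\<omega>. \<lambda>i\<in>{0..K}. X i \<omega>)) E" .
  qed simp
qed

subsection \<open>Strict stationarity\<close>

text \<open>Any window starting at \<open>s\<close> is a projection of a path starting at 0, so
  shifting such paths by one step suffices; induction on \<open>s\<close> does the rest. The path up
  to \<open>Suc (s + k)\<close> has \<open>K \<ge> 1\<close> even for
  \<open>s = k = 0\<close>.\<close>

lemma strictly_stationaryI:
  fixes X :: "nat \<Rightarrow> 'w \<Rightarrow> 'b::topological_space"
  assumes X: "\<And>t. X t \<in> borel_measurable M"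
    and shift: "\<And>K. K \<ge> 1 \<Longrightarrow> distr M (Pi\<^sub>M {0..K} (\<lambda>_. borel)) (\<lambda>\<omega>. \<lambda>i\<in>{0..K}. X (Suc i) \<omega>)
      = distr M (Pi\<^sub>M {0..K} (\<lambda>_. borel)) (\<lambda>\<omega>. \<lambda>i\<in>{0..K}. X i \<omega>)"
  shows "strictly_stationary M X"
  unfolding strictly_stationary_def
proof (intro allI)
  fix k s s' :: nat
  let ?law = "\<lambda>s. distr M (Pi\<^sub>M {0..k} (\<lambda>_. borel)) (\<lambda>\<omega>. \<lambda>i\<in>{0..k}. X (s + i) \<omega>)"
  have "?law (Suc s) = ?law s" for s
  proof -
    let ?P = "Pi\<^sub>M {0..Suc (s + k)} (\<lambda>_. borel) :: (nat \<Rightarrow> 'b) measure"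
    let ?r = "\<lambda>x. \<lambda>i\<in>{0..k}. x (s + i)"
    have r: "?r \<in> ?P \<rightarrow>\<^sub>M Pi\<^sub>M {0..k} (\<lambda>_. borel)"
      by (intro measurable_restrict measurable_component_singleton) auto
    have *: "distr M (Pi\<^sub>M {0..k} (\<lambda>_. borel)) (\<lambda>\<omega>. \<lambda>i\<in>{0..k}. Y (s + i) \<omega>)
        = distr (distr M ?P (\<lambda>\<omega>. \<lambda>i\<in>{0..Suc (s + k)}. Y i \<omega>)) (Pi\<^sub>M {0..k} (\<lambda>_. borel)) ?r"
      if "\<And>i. Y i \<in> borel_measurable M" for Y
    proof -
      have "(\<lambda>\<omega>. \<lambda>i\<in>{0..Suc (s + k)}. Y i \<omega>) \<in> M \<rightarrow>\<^sub>M ?P"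
        by (intro measurable_restrict that)
      then show ?thesis
        by (subst distr_distr[OF r]) (auto intro!: distr_cong simp: comp_def fun_eq_iff)
    qed
    show ?thesis
      using *[of X] *[of "\<lambda>i. X (Suc i)"] shift[of "Suc (s + k)"] X by simp
  qed
  then have "?law s = ?law 0" for s
    by (induction s) simp_all
  then show "?law s = ?law s'" by metis
qed

lemma iwar_process_strictly_stationary:
  fixes S F :: "real^'q^'q"
  assumes n: "n > 0" and S: "transpose S = S" and posdef: "posdef (iwar_scale n F S)"
    and process: "iwar_process n F S M \<Sigma>"
  shows "strictly_stationary M \<Sigma>"
proof -
  define L where "L = (sym_lborel :: (real^'q^'q) measure)"
  have L: "sigma_finite_measure L" and [measurable_cong]: "sets L = sets borel"
    by (simp_all add: L_def sigma_finite_sym_lborel)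
  interpret L: sigma_finite_measure L by (rule L)
  define g where "g = iw_density (n + 2) (n *\<^sub>R S)"
  have g: "g \<in> borel_measurable L"
    unfolding g_def by measurable
  define N where "N = inverse_wishart (n + 2) (iwar_scale n F S)"
  from process obtain p where "prob_space M" and \<Sigma>: "\<And>t. \<Sigma> t \<in> borel_measurable M"
    and p: "distributed N (L \<Otimes>\<^sub>M L) (\<lambda>X. (upper_block X, lower_block X)) p"
    and law: "\<And>T. T \<ge> 1 \<Longrightarrow> distributed M (Pi\<^sub>M {0..T} (\<lambda>_. L)) (\<lambda>\<omega>. \<lambda>t\<in>{0..T}. \<Sigma> t \<omega>) (markov_density p g T)"
    unfolding iwar_process_def iwar_pair_density_def L_def N_def g_def markov_density_def[abs_def]
    by blast
  have p_measurable[measurable]: "p \<in> borel_measurable (L \<Otimes>\<^sub>M L)"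
    by (rule distributed_borel_measurable[OF p])
  interpret M: prob_space M by fact

  \<comment> \<open>The total mass of \<open>N\<close> is the integral of \<open>p\<close>. That
    integral is 1 because \<open>p\<close> is also the joint density of the first two states of the
    process under the probability measure \<open>M\<close>.\<close>
  have "emeasure N (space N) = (\<integral>\<^sup>+w. p w \<partial>(L \<Otimes>\<^sub>M L))"
    using distributed_nn_integral[OF p, of "\<lambda>_. 1"] by simp
  also have "\<dots> = (\<integral>\<^sup>+a. \<integral>\<^sup>+b. p (a, b) \<partial>L \<partial>L)"
    by (rule L.nn_integral_fst[symmetric]) simp
  also have "\<dots> = (\<integral>\<^sup>+x. p (x 0, x (Suc 0)) \<partial>Pi\<^sub>M {0..Suc 0} (\<lambda>_. L))"
    by (rule nn_integral_PiM_two[OF L, symmetric]) simp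
  also have "\<dots> = 1"
    using distributed_nn_integral[OF law, of 1 "\<lambda>_. 1"]
    by (simp add: markov_density_def divide_ennreal_def M.emeasure_space_1)
  finally interpret N: prob_space N
    by (rule prob_spaceI)

  \<comment> \<open>The two marginals of \<open>p\<close> are densities of the block laws, which
    coincide; uniqueness of densities gives equality almost everywhere.\<close>
  have "AE x in L. (\<integral>\<^sup>+y. p (x, y) \<partial>L) = (\<integral>\<^sup>+y. p (y, x) \<partial>L)"
  proof (rule L.density_unique)
    have "density L (\<lambda>x. \<integral>\<^sup>+y. p (x, y) \<partial>L) = distr N L upper_block"
      using distributed_distr_eq_density[OF N.distr_marginal1[OF L L p]] by simp
    also have "\<dots> = distr N borel upper_block"
      by (rule distr_cong) (simp_all add: L_def)
    also have "\<dots> = distr N borel lower_block"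
      unfolding N_def by (rule distr_lower_block_eq_upper_block[OF n posdef S, symmetric])
    also have "\<dots> = distr N L lower_block"
      by (rule distr_cong) (simp_all add: L_def)
    also have "\<dots> = density L (\<lambda>x. \<integral>\<^sup>+y. p (y, x) \<partial>L)"
      using distributed_distr_eq_density[OF N.distr_marginal2[OF L L p]] by simp
    finally show "density L (\<lambda>x. \<integral>\<^sup>+y. p (x, y) \<partial>L) = density L (\<lambda>x. \<integral>\<^sup>+y. p (y, x) \<partial>L)" .
  qed measurable
  note shift = markov_density_shift[OF \<open>prob_space M\<close> L p_measurable g this law]

  \<comment> \<open>The shift lemma speaks of products of \<open>L\<close>, stationarity of products
    of \<open>borel\<close>; an image measure depends on its target only through the measurable
    sets.\<close>
  have "sets (Pi\<^sub>M {0..K} (\<lambda>_. L)) = sets (Pi\<^sub>M {0..K} (\<lambda>_. borel))" for K :: nat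
    by (rule sets_PiM_cong) (simp_all add: L_def)
  then have "distr M (Pi\<^sub>M {0..K} (\<lambda>_. borel)) f = distr M (Pi\<^sub>M {0..K} (\<lambda>_. L)) f" for K :: nat and f
    by (intro distr_cong) simp_all
  with shift \<Sigma> show ?thesis
    by (intro strictly_stationaryI) simp_all
qed

theorem theorem3p1:
  fixes n :: real and S F :: "real^'q^'q"
  assumes "n > 0" and "transpose S = S"
  shows "(iw_valid (n + 2) (iwar_scale n F S) \<longleftrightarrow>
            posdef S \<and> posdef (S - F ** S ** transpose F)) \<and>
         (posdef S \<and> posdef (S - F ** S ** transpose F) \<longrightarrow>
            (\<forall>(M :: 'w measure) \<Sigma>. iwar_process n F S M \<Sigma> \<longrightarrow> strictly_stationary M \<Sigma>))"
  using assms iwar_process_strictly_stationary[OF assms]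
  by (auto simp: iw_valid_def posdef_iwar_scale_iff)

end
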